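(* Let $\xi\in\mathbb{C}$. Let $K^{\xi,\ell}(x):V^\ell\to V^\ell$ ($\ell\in\frac12\mathbb{Z}_{\ge0}$) be the operators obtained by recursive fusion from $K^{\xi,\frac12}(x)$, i.e. $K^{\xi,0}(x)=\mathrm{Id}_{V^0}$, $K^{\xi,\frac12}(x)$ is given by $K^{\xi,\frac12}(x)v_1^{\frac12}=v_1^{\frac12}$, $K^{\xi,\frac12}(x)v_2^{\frac12}=\frac{\sinh(\xi-x)}{\sinh(\xi+x)}v_2^{\frac12}$, and $$j^kK^{\xi,k+\frac12}(x)=P^{\frac12k}K^{\xi,\frac12}_1(x-k\eta)\,R^{\frac12k}\bigl(2x-(k-\tfrac12)\eta\bigr)\,K_2^{\xi,k}(x+\tfrac{\eta}{2})\,\iota^k$$ for all $k\in\frac12\mathbb{Z}_{\ge1}$. Then $K^{\xi,\ell}(x)$ acts on the weight basis of $V^\ell$ as $$K^{\xi,\ell}(x)v_n^\ell=C_n^\ell(x;\xi)v_n^\ell,\qquad1\le n\le2\ell+1,$$ where $$C_n^\ell(x;\xi):=\prod_{j=1}^{n-1}\frac{\sinh(\xi-x+(\ell+\frac12-j)\eta)}{\sinh(\xi+x+(\ell+\frac12-j)\eta)}$$ for $n\in\mathbb{Z}_{>1}$ and $C_1^\ell(x;\xi)=1$.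
   Context: Quantum affine $\mathfrak{sl}_2$. Fix $\eta\in\mathbb{C}$ generic, in particular such that $p:=e^\eta$ is not a root of unity; $p^x:=e^{\eta x}$. Let $\mathfrak{h}=\mathbb{C}h_0\oplus\mathbb{C}h_1$. $\widehat{\mathcal{U}}_\eta$ is the Hopf algebra generated by $e_i,f_i$ ($i=0,1$), $p^h$ ($h\in\mathfrak{h}$) with relations $p^0=1$, $p^{h+h'}=p^hp^{h'}$, $p^he_ip^{-h}=p^{\alpha_i(h)}e_i$, $p^hf_ip^{-h}=p^{-\alpha_i(h)}f_i$, $[e_i,f_j]=\delta_{i,j}\frac{p^{h_i}-p^{-h_i}}{p-p^{-1}}$ and, for $i\neq j$, $e_i^3e_j-(p^2+1+p^{-2})e_i^2e_je_i+(p^2+1+p^{-2})e_ie_je_i^2-e_je_i^3=0$ and the same with $f$'s; here $\alpha_j(h_i)=2$ if $i=j$ and $-2$ if $i\ne j$. Comultiplication: $\Delta(p^h)=p^h\otimes p^h$, $\Delta(e_i)=e_i\otimes1+p^{-h_i}\otimes e_i$, $\Delta(f_i)=f_i\otimes p^{h_i}+1\otimes f_i$; $\Delta^{\mathrm{op}}$ is the opposite comultiplication. $\mathcal{U}_\eta$ is the subalgebra generated by $e_1,f_1,p^{\lambda h_1}$ ($\lambda\in\mathbb{C}$). Modules. For $\ell\in\mathbb{C}$, $M^\ell=\bigoplus_{n\ge1}\mathbb{C}m_n^\ell$ is the $\mathcal{U}_\eta$-module with $\pi^\ell(p^{\lambda h_1})m_n^\ell=p^{2\lambda(\ell+1-n)}m_n^\ell$,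 $\pi^\ell(e_1)m_n^\ell=\frac{\sinh((n-1)\eta)\sinh((2\ell+2-n)\eta)}{\sinh(\eta)^2}m_{n-1}^\ell$, $\pi^\ell(f_1)m_n^\ell=m_{n+1}^\ell$ ($m_0^\ell:=0$). For $k\in\frac12\mathbb{Z}_{\ge0}$, $V^k$ is the quotient of $M^k$ by the submodule $\bigoplus_{n\ge2k+2}\mathbb{C}m_n^k$, $\mathrm{pr}^k:M^k\to V^k$ is the projection, and $v_n^k=\mathrm{pr}^k(m_n^k)$ ($1\le n\le2k+1$) is the weight basis of $V^k$. For $x\in\mathbb{C}$, $\phi_x:\widehat{\mathcal{U}}_\eta\to\mathcal{U}_\eta$ is the algebra homomorphism with $p^{\lambda h_0}\mapsto p^{-\lambda h_1}$, $p^{\lambda h_1}\mapsto p^{\lambda h_1}$, $e_0\mapsto e^{-x}f_1$, $e_1\mapsto e^{-x}e_1$, $f_0\mapsto e^xe_1$, $f_1\mapsto e^xf_1$; $\pi^\ell_x:=\pi^\ell\circ\phi_x$. $R$-operators. For $k,\ell\in\mathbb{C}$, $\mathcal{R}^{k\ell}(x)$ is the linear operator on $M^k\otimes M^\ell$, with matrix coefficients rational in $e^x$, uniquely determined by $\mathcal{R}^{k\ell}(x)(m_1^k\otimes m_1^\ell)=m_1^k\otimes m_1^\ell$ and, for generic $x,y$, $\mathcal{R}^{k\ell}(x-y)(\pi^k_x\otimes\pi^\ell_y)(\Delta(X))=(\pi_x^k\otimes\pi_y^\ell)(\Delta^{\mathrm{op}}(X))\mathcal{R}^{k\ell}(x-y)$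 for all $X\in\widehat{\mathcal{U}}_\eta$. For $k,\ell\in\frac12\mathbb{Z}_{\ge0}$, $R^{k\ell}(x)$ is the unique operator on $V^k\otimes V^\ell$ with $(\mathrm{pr}^k\otimes\mathrm{pr}^\ell)\mathcal{R}^{k\ell}(x)=R^{k\ell}(x)(\mathrm{pr}^k\otimes\mathrm{pr}^\ell)$. Notation. $P^{k\ell}:V^k\otimes V^\ell\to V^\ell\otimes V^k$ is the permutation operator. On a two-fold tensor product, $K_1(x)=K(x)\otimes\mathrm{Id}$ and $K_2(y)=\mathrm{Id}\otimes K(y)$. Set $v_0^k:=0$, $v_{2k+2}^k:=0$. The injective linear map $\iota^k:V^{k+\frac12}\to V^{\frac12}\otimes V^k$ is $$\iota^k(v_n^{k+\frac12})=e^{\frac{\eta}{2}(n-1)}v_1^{\frac12}\otimes v_n^k+e^{-\frac{\eta}{2}(n-2-2k)}\frac{\sinh((n-1)\eta)}{\sinh(\eta)}v_2^{\frac12}\otimes v_{n-1}^k,$$ and $j^k:=P^{\frac12k}\iota^k:V^{k+\frac12}\to V^k\otimes V^{\frac12}$. Since $j^k$ is injective the recursion determines the $K^{\xi,\ell}(x)$ uniquely; such operators, meromorphic in $x$, exist because $K^{\xi,\frac12}(x)$ satisfies the reflection equation for $R^{\frac12\frac12}$. *)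

theory Defs
  imports "HOL-Complex_Analysis.Meromorphic" "HOL-Library.Poly_Mapping"
    "HOL-Library.Product_Plus" "HOL-Computational_Algebra.Polynomial"
begin

section \<open>Vector spaces with a distinguished basis\<close>

text \<open>
  A complex vector space with a basis labelled by a set \<open>B\<close> is modelled as the space of finitely
  supported functions with support in \<open>B\<close>. The tensor product of two such spaces is the space
  over the product label set.
\<close>

type_synonym 'b vec = "'b \<Rightarrow>\<^sub>0 complex"
type_synonym 'b opr = "'b vec \<Rightarrow> 'b vec"

definition span_of :: "'b set \<Rightarrow> 'b vec set" where
  "span_of B = {u. Poly_Mapping.keys u \<subseteq> B}"

definition bvec :: "'b \<Rightarrow> 'b vec" where
  "bvec b = Poly_Mapping.single b 1"

definition smul :: "complex \<Rightarrow> 'b vec \<Rightarrow> 'b vec"  (infixr "\<cdot>" 75) where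
  "c \<cdot> u = Poly_Mapping.map ((*) c) u"

definition lin_ext :: "('b \<Rightarrow> 'c vec) \<Rightarrow> 'b vec \<Rightarrow> 'c vec" where
  "lin_ext A u = (\<Sum>b\<in>Poly_Mapping.keys u. Poly_Mapping.lookup u b \<cdot> A b)"

definition linear_op :: "'b set \<Rightarrow> 'c set \<Rightarrow> ('b vec \<Rightarrow> 'c vec) \<Rightarrow> bool" where
  "linear_op B C T \<longleftrightarrow>
     (\<forall>u\<in>span_of B. T u \<in> span_of C) \<and>
     (\<forall>u\<in>span_of B. \<forall>w\<in>span_of B. T (u + w) = T u + T w) \<and>
     (\<forall>c. \<forall>u\<in>span_of B. T (c \<cdot> u) = c \<cdot> T u)"

definition tens :: "'b vec \<Rightarrow> 'c vec \<Rightarrow> ('b \<times> 'c) vec"  (infixr "\<otimes>\<^sub>v" 76) where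
  "u \<otimes>\<^sub>v w = (\<Sum>b\<in>Poly_Mapping.keys u. \<Sum>c\<in>Poly_Mapping.keys w.
      Poly_Mapping.single (b, c) (Poly_Mapping.lookup u b * Poly_Mapping.lookup w c))"

definition tens_op :: "('b vec \<Rightarrow> 'd vec) \<Rightarrow> ('c vec \<Rightarrow> 'e vec) \<Rightarrow> ('b \<times> 'c) vec \<Rightarrow> ('d \<times> 'e) vec"
    (infixr "\<otimes>\<^sub>o" 76) where
  "S \<otimes>\<^sub>o T = lin_ext (\<lambda>(b, c). S (bvec b) \<otimes>\<^sub>v T (bvec c))"

definition perm_op :: "('b \<times> 'c) vec \<Rightarrow> ('c \<times> 'b) vec" where
  "perm_op = lin_ext (\<lambda>(b, c). bvec (c, b))"


section \<open>Algebras given by generators and relations\<close>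

datatype 'g fexpr = Gen 'g | Scal complex | Add "'g fexpr" "'g fexpr" | Mul "'g fexpr" "'g fexpr"

instantiation fexpr :: (type) "{zero, one, plus, minus, times}"
begin
definition "0 = Scal 0"
definition "1 = Scal 1"
definition "a + b = Add a b"
definition "a - b = Add a (Mul (Scal (-1)) b)"
definition "a * b = Mul a b"
instance ..
end

instance fexpr :: (type) power ..

text \<open>
  The congruence generated by the axioms of a unital associative complex algebra and the
  relations \<open>r\<close>. The quotient of all expressions by it is the algebra presented by the
  generators \<open>'g\<close> and the relations \<open>r\<close>.
\<close>

inductive alg_cong :: "('g fexpr \<Rightarrow> 'g fexpr \<Rightarrow> bool) \<Rightarrow> 'g fexpr \<Rightarrow> 'g fexpr \<Rightarrow> bool"
  for r where
  rel: "r a b \<Longrightarrow> alg_cong r a b"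
| refl: "alg_cong r a a"
| sym: "alg_cong r a b \<Longrightarrow> alg_cong r b a"
| trans: "alg_cong r a b \<Longrightarrow> alg_cong r b c \<Longrightarrow> alg_cong r a c"
| add: "alg_cong r a a' \<Longrightarrow> alg_cong r b b' \<Longrightarrow> alg_cong r (a + b) (a' + b')"
| mul: "alg_cong r a a' \<Longrightarrow> alg_cong r b b' \<Longrightarrow> alg_cong r (a * b) (a' * b')"
| add_assoc: "alg_cong r ((a + b) + c) (a + (b + c))"
| add_comm: "alg_cong r (a + b) (b + a)"
| add_zero: "alg_cong r (a + 0) a"
| diff_self: "alg_cong r (a - a) 0"
| mul_assoc: "alg_cong r ((a * b) * c) (a * (b * c))"
| one_left: "alg_cong r (1 * a) a"
| one_right: "alg_cong r (a * 1) a"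
| distrib_left: "alg_cong r (a * (b + c)) (a * b + a * c)"
| distrib_right: "alg_cong r ((a + b) * c) (a * c + b * c)"
| scal_add: "alg_cong r (Scal x + Scal y) (Scal (x + y))"
| scal_mul: "alg_cong r (Scal x * Scal y) (Scal (x * y))"
| scal_central: "alg_cong r (Scal x * a) (a * Scal x)"

primrec act :: "('g \<Rightarrow> 'b opr) \<Rightarrow> 'g fexpr \<Rightarrow> 'b opr" where
  "act \<rho> (Gen g) = \<rho> g"
| "act \<rho> (Scal c) = smul c"
| "act \<rho> (Add a b) = (\<lambda>u. act \<rho> a u + act \<rho> b u)"
| "act \<rho> (Mul a b) = act \<rho> a \<circ> act \<rho> b"

primrec alg_hom :: "('g \<Rightarrow> 'h fexpr) \<Rightarrow> 'g fexpr \<Rightarrow> 'h fexpr" where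
  "alg_hom \<phi> (Gen g) = \<phi> g"
| "alg_hom \<phi> (Scal c) = Scal c"
| "alg_hom \<phi> (Add a b) = alg_hom \<phi> a + alg_hom \<phi> b"
| "alg_hom \<phi> (Mul a b) = alg_hom \<phi> a * alg_hom \<phi> b"


section \<open>Quantum affine sl(2)\<close>

datatype node = N0 | N1

text \<open>The pair \<open>(a, b)\<close> stands for \<open>a h\<^sub>0 + b h\<^sub>1\<close>; \<open>q_ph h\<close> is the generator \<open>p\<^sup>h\<close>.\<close>

datatype uhat_gen = q_e node | q_f node | q_ph "complex \<times> complex"

definition coroot :: "node \<Rightarrow> complex \<times> complex" where
  "coroot i = (case i of N0 \<Rightarrow> (1, 0) | N1 \<Rightarrow> (0, 1))"

definition alpha :: "node \<Rightarrow> complex \<times> complex \<Rightarrow> complex" where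
  "alpha j h = (case j of N0 \<Rightarrow> 2 * fst h - 2 * snd h | N1 \<Rightarrow> 2 * snd h - 2 * fst h)"

definition pw :: "complex \<Rightarrow> complex \<Rightarrow> complex" where
  "pw \<eta> x = exp (\<eta> * x)"

definition serre :: "complex \<Rightarrow> uhat_gen fexpr \<Rightarrow> uhat_gen fexpr \<Rightarrow> uhat_gen fexpr" where
  "serre \<eta> a b =
     a ^ 3 * b - Scal (pw \<eta> 2 + 1 + pw \<eta> (-2)) * a ^ 2 * b * a
     + Scal (pw \<eta> 2 + 1 + pw \<eta> (-2)) * a * b * a ^ 2 - b * a ^ 3"

inductive uhat_rel :: "complex \<Rightarrow> uhat_gen fexpr \<Rightarrow> uhat_gen fexpr \<Rightarrow> bool" for \<eta> where
  "uhat_rel \<eta> (Gen (q_ph 0)) 1"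
| "uhat_rel \<eta> (Gen (q_ph (h + h'))) (Gen (q_ph h) * Gen (q_ph h'))"
| "uhat_rel \<eta> (Gen (q_ph h) * Gen (q_e i) * Gen (q_ph (- h))) (Scal (pw \<eta> (alpha i h)) * Gen (q_e i))"
| "uhat_rel \<eta> (Gen (q_ph h) * Gen (q_f i) * Gen (q_ph (- h))) (Scal (pw \<eta> (- alpha i h)) * Gen (q_f i))"
| "uhat_rel \<eta> (Gen (q_e i) * Gen (q_f i) - Gen (q_f i) * Gen (q_e i))
     (Scal (1 / (pw \<eta> 1 - pw \<eta> (-1))) * (Gen (q_ph (coroot i)) - Gen (q_ph (- coroot i))))"
| "i \<noteq> j \<Longrightarrow> uhat_rel \<eta> (Gen (q_e i) * Gen (q_f j) - Gen (q_f j) * Gen (q_e i)) 0"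
| "i \<noteq> j \<Longrightarrow> uhat_rel \<eta> (serre \<eta> (Gen (q_e i)) (Gen (q_e j))) 0"
| "i \<noteq> j \<Longrightarrow> uhat_rel \<eta> (serre \<eta> (Gen (q_f i)) (Gen (q_f j))) 0"

definition Uhat :: "complex \<Rightarrow> uhat_gen fexpr set set" where
  "Uhat \<eta> = UNIV // {(a, b). alg_cong (uhat_rel \<eta>) a b}"

text \<open>
  Elements of a tensor product of algebras are written as lists of pure tensors, to be read as
  their sum. The comultiplication is the algebra homomorphism given on generators by
  \<open>coprod_gen\<close>, computed on representatives of the classes in \<open>Uhat\<close>.
\<close>

definition coprod_gen :: "uhat_gen \<Rightarrow> (uhat_gen fexpr \<times> uhat_gen fexpr) list" where
  "coprod_gen g = (case g of
     q_ph h \<Rightarrow> [(Gen (q_ph h), Gen (q_ph h))]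
   | q_e i \<Rightarrow> [(Gen (q_e i), 1), (Gen (q_ph (- coroot i)), Gen (q_e i))]
   | q_f i \<Rightarrow> [(Gen (q_f i), Gen (q_ph (coroot i))), (1, Gen (q_f i))])"

primrec coprod :: "uhat_gen fexpr \<Rightarrow> (uhat_gen fexpr \<times> uhat_gen fexpr) list" where
  "coprod (Gen g) = coprod_gen g"
| "coprod (Scal c) = [(Scal c, 1)]"
| "coprod (Add a b) = coprod a @ coprod b"
| "coprod (Mul a b) =
     concat (map (\<lambda>(s, t). map (\<lambda>(s', t'). (s * s', t * t')) (coprod b)) (coprod a))"

definition coprod_op :: "uhat_gen fexpr \<Rightarrow> (uhat_gen fexpr \<times> uhat_gen fexpr) list" where
  "coprod_op a = map prod.swap (coprod a)"

definition tens_rep ::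
  "('g fexpr \<Rightarrow> 'b opr) \<Rightarrow> ('h fexpr \<Rightarrow> 'c opr) \<Rightarrow> ('g fexpr \<times> 'h fexpr) list \<Rightarrow> ('b \<times> 'c) opr" where
  "tens_rep \<pi> \<rho> ts u = (\<Sum>(a, b)\<leftarrow>ts. (\<pi> a \<otimes>\<^sub>o \<rho> b) u)"


section \<open>Modules\<close>

text \<open>
  The subalgebra generated by \<open>e\<^sub>1\<close>, \<open>f\<^sub>1\<close> and \<open>p\<close> to the \<open>c h\<^sub>1\<close>: its elements are represented
  by expressions in the generators \<open>s_e\<close>, \<open>s_f\<close>, \<open>s_ph c\<close>.
\<close>

datatype u_gen = s_e | s_f | s_ph complex

text \<open>The Verma-type module has basis \<open>mvec n\<close> for \<open>n \<ge> 1\<close>; label 0 is not used.\<close>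

definition M_ix :: "nat set" where "M_ix = {1..}"

definition mvec :: "nat \<Rightarrow> nat vec" where
  "mvec n = (if n = 0 then 0 else bvec n)"

definition pi_gen :: "complex \<Rightarrow> complex \<Rightarrow> u_gen \<Rightarrow> nat opr" where
  "pi_gen \<eta> l g = (case g of
     s_ph c \<Rightarrow> lin_ext (\<lambda>n. pw \<eta> (2 * c * (l + 1 - of_nat n)) \<cdot> mvec n)
   | s_e \<Rightarrow> lin_ext (\<lambda>n. (sinh ((of_nat n - 1) * \<eta>) * sinh ((2 * l + 2 - of_nat n) * \<eta>)
                         / sinh \<eta> ^ 2) \<cdot> mvec (n - 1))
   | s_f \<Rightarrow> lin_ext (\<lambda>n. mvec (n + 1)))"

definition pi_rep :: "complex \<Rightarrow> complex \<Rightarrow> u_gen fexpr \<Rightarrow> nat opr" where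
  "pi_rep \<eta> l = act (pi_gen \<eta> l)"

definition phi_gen :: "complex \<Rightarrow> uhat_gen \<Rightarrow> u_gen fexpr" where
  "phi_gen x g = (case g of
     q_ph h \<Rightarrow> Gen (s_ph (snd h - fst h))
   | q_e N0 \<Rightarrow> Scal (exp (- x)) * Gen s_f
   | q_e N1 \<Rightarrow> Scal (exp (- x)) * Gen s_e
   | q_f N0 \<Rightarrow> Scal (exp x) * Gen s_e
   | q_f N1 \<Rightarrow> Scal (exp x) * Gen s_f)"

definition pi_x :: "complex \<Rightarrow> complex \<Rightarrow> complex \<Rightarrow> uhat_gen fexpr \<Rightarrow> nat opr" where
  "pi_x \<eta> l x = pi_rep \<eta> l \<circ> alg_hom (phi_gen x)"

text \<open>
  Spins in half the natural numbers are encoded by twice their value: below, \<open>V_ix d\<close>, \<open>pr d\<close>,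
  \<open>vvec d\<close> refer to the module of spin \<open>d/2\<close>, of dimension \<open>d + 1\<close>. The quotient of the
  Verma-type module by the span of \<open>mvec n\<close>, \<open>n \<ge> d + 2\<close>, is realised on the remaining labels.
\<close>

definition V_ix :: "nat \<Rightarrow> nat set" where "V_ix d = {1..d + 1}"

definition pr :: "nat \<Rightarrow> nat opr" where
  "pr d = lin_ext (\<lambda>n. if n \<in> V_ix d then bvec n else 0)"

text \<open>In particular \<open>vvec d 0 = 0\<close> and \<open>vvec d (d + 2) = 0\<close>.\<close>

definition vvec :: "nat \<Rightarrow> nat \<Rightarrow> nat vec" where
  "vvec d n = pr d (mvec n)"


section \<open>R-operators\<close>

text \<open>
  With numerator and denominator coprime, the value is prescribed wherever the rational
  function is regular and left free at its poles.
\<close>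

definition rational_in_exp :: "(complex \<Rightarrow> complex) \<Rightarrow> bool" where
  "rational_in_exp f \<longleftrightarrow>
     (\<exists>a b :: complex poly. b \<noteq> 0 \<and> coprime a b \<and>
        (\<forall>z. poly b (exp z) \<noteq> 0 \<longrightarrow> f z = poly a (exp z) / poly b (exp z)))"

text \<open>
  Genericity of the spectral parameters means: their difference avoids some countable set. (On
  an infinite-dimensional module the poles of the matrix coefficients may accumulate, but they
  form a countable set.) An element \<open>X\<close> of \<open>Uhat\<close> is a class of expressions, and it acts
  through any representative \<open>a\<close>.
\<close>

definition verma_R_operator ::
  "complex \<Rightarrow> complex \<Rightarrow> complex \<Rightarrow> (complex \<Rightarrow> (nat \<times> nat) opr) \<Rightarrow> bool" where
  "verma_R_operator \<eta> k l R \<longleftrightarrow>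
     (\<forall>z. linear_op (M_ix \<times> M_ix) (M_ix \<times> M_ix) (R z)) \<and>
     (\<forall>b \<in> M_ix \<times> M_ix. \<forall>c \<in> M_ix \<times> M_ix. rational_in_exp (\<lambda>z. Poly_Mapping.lookup (R z (bvec b)) c)) \<and>
     (\<forall>z. R z (mvec 1 \<otimes>\<^sub>v mvec 1) = mvec 1 \<otimes>\<^sub>v mvec 1) \<and>
     (\<exists>S. countable S \<and> (\<forall>x y. x - y \<notin> S \<longrightarrow>
        (\<forall>X \<in> Uhat \<eta>. \<forall>a \<in> X. \<forall>u \<in> span_of (M_ix \<times> M_ix).
           R (x - y) (tens_rep (pi_x \<eta> k x) (pi_x \<eta> l y) (coprod a) u)
           = tens_rep (pi_x \<eta> k x) (pi_x \<eta> l y) (coprod_op a) (R (x - y) u))))"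

text \<open>The operator on the tensor product of the modules of spins \<open>c/2\<close> and \<open>d/2\<close>.\<close>

definition R_operator :: "complex \<Rightarrow> nat \<Rightarrow> nat \<Rightarrow> (complex \<Rightarrow> (nat \<times> nat) opr) \<Rightarrow> bool" where
  "R_operator \<eta> c d R \<longleftrightarrow>
     (\<forall>z. linear_op (V_ix c \<times> V_ix d) (V_ix c \<times> V_ix d) (R z)) \<and>
     (\<forall>b \<in> V_ix c \<times> V_ix d. \<forall>b' \<in> V_ix c \<times> V_ix d.
        rational_in_exp (\<lambda>z. Poly_Mapping.lookup (R z (bvec b)) b')) \<and>
     (\<exists>RM. verma_R_operator \<eta> (of_nat c / 2) (of_nat d / 2) RM \<and>
        (\<exists>S. countable S \<and> (\<forall>z. z \<notin> S \<longrightarrow> (\<forall>u \<in> span_of (M_ix \<times> M_ix).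
           (pr c \<otimes>\<^sub>o pr d) (RM z u) = R z ((pr c \<otimes>\<^sub>o pr d) u)))))"


section \<open>Fusion of K-operators\<close>

definition iota :: "complex \<Rightarrow> nat \<Rightarrow> nat vec \<Rightarrow> (nat \<times> nat) vec" where
  "iota \<eta> d = lin_ext (\<lambda>n.
     exp (\<eta> / 2 * (of_nat n - 1)) \<cdot> (vvec 1 1 \<otimes>\<^sub>v vvec d n)
     + (exp (- (\<eta> / 2) * (of_nat n - 2 - of_nat d)) * sinh ((of_nat n - 1) * \<eta>) / sinh \<eta>)
       \<cdot> (vvec 1 2 \<otimes>\<^sub>v vvec d (n - 1)))"

definition jmap :: "complex \<Rightarrow> nat \<Rightarrow> nat vec \<Rightarrow> (nat \<times> nat) vec" where
  "jmap \<eta> d = perm_op \<circ> iota \<eta> d"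

text \<open>
  \<open>R d\<close> is the R-operator for the spins \<open>1/2\<close> and \<open>d/2\<close>, and \<open>K d\<close> the K-operator on the module
  of spin \<open>d/2\<close>. The recursion is an identity of meromorphic functions: it is required
  outside a set without limit points, so as to avoid poles. The matrix coefficients of \<open>K d\<close> are
  normalised meromorphic functions (the value is the limit wherever that is finite).
\<close>

definition fused_K_operators ::
  "complex \<Rightarrow> complex \<Rightarrow> (nat \<Rightarrow> complex \<Rightarrow> (nat \<times> nat) opr) \<Rightarrow> (nat \<Rightarrow> complex \<Rightarrow> nat opr) \<Rightarrow> bool" where
  "fused_K_operators \<eta> \<xi> R K \<longleftrightarrow>
     (\<forall>d x. linear_op (V_ix d) (V_ix d) (K d x)) \<and>
     (\<forall>d. \<forall>m \<in> V_ix d. \<forall>n \<in> V_ix d.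
        (\<lambda>x. Poly_Mapping.lookup (K d x (vvec d m)) n) nicely_meromorphic_on UNIV) \<and>
     (\<forall>x. \<forall>u \<in> span_of (V_ix 0). K 0 x u = u) \<and>
     (\<forall>x. K 1 x (vvec 1 1) = vvec 1 1) \<and>
     (\<forall>x. sinh (\<xi> + x) \<noteq> 0 \<longrightarrow>
        K 1 x (vvec 1 2) = (sinh (\<xi> - x) / sinh (\<xi> + x)) \<cdot> vvec 1 2) \<and>
     (\<forall>d \<ge> 1. \<forall>\<^sub>\<approx>x. \<forall>u \<in> span_of (V_ix (d + 1)).
        jmap \<eta> d (K (d + 1) x u) =
        perm_op ((K 1 (x - of_nat d / 2 * \<eta>) \<otimes>\<^sub>o id)
          (R d (2 * x - (of_nat d / 2 - 1 / 2) * \<eta>)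
            ((id \<otimes>\<^sub>o K d (x + \<eta> / 2)) (iota \<eta> d u)))))"

definition C_coeff :: "complex \<Rightarrow> complex \<Rightarrow> nat \<Rightarrow> complex \<Rightarrow> complex \<Rightarrow> complex" where
  "C_coeff \<eta> l n x \<xi> = (\<Prod>j = 1..n - 1.
     sinh (\<xi> - x + (l + 1 / 2 - of_nat j) * \<eta>) / sinh (\<xi> + x + (l + 1 / 2 - of_nat j) * \<eta>))"

end

theory Submission
  imports Defs
begin

text \<open>
  The operator \<open>R\<close> preserves weights, and a weight space of the tensor product of the modules of
  spins 1/2 and \<open>l = d/2\<close> is spanned by \<open>v\<^sub>1 \<otimes> v\<^sub>n\<close> and \<open>v\<^sub>2 \<otimes> v\<^sub>n\<^sub>-\<^sub>1\<close>. If the K-operators for the spins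
  1/2 and \<open>l\<close> are diagonal, the fusion recursion therefore decomposes into statements about
  vectors with two components, and since \<open>iota\<close> is injective it forces the operator for spin
  \<open>l + 1/2\<close> to be diagonal, with eigenvalues given by one scalar identity per weight.

  The needed entries of \<open>R\<close> come from the intertwining property for the two generators \<open>f\<^sub>1\<close> and
  \<open>e\<^sub>0\<close>. Both act by a multiple of the lowering map \<open>m\<^sub>n \<mapsto> m\<^sub>n\<^sub>+\<^sub>1\<close>, but with different twists, so that
  they give two linear equations for the images of \<open>m\<^sub>1 \<otimes> m\<^sub>n\<^sub>+\<^sub>1\<close> and \<open>m\<^sub>2 \<otimes> m\<^sub>n\<close> in terms of the image
  of \<open>m\<^sub>1 \<otimes> m\<^sub>n\<close>. The determinant of this system is generically nonzero, and starting from the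
  normalisation at \<open>m\<^sub>1 \<otimes> m\<^sub>1\<close> it determines these columns of \<open>R\<close> (\<open>verma_R_spin_half\<close>). The entries
  are quotients of hyperbolic sines whose numerators telescope.

  For \<open>n \<le> d + 1\<close> the coefficient of \<open>v\<^sub>1 \<otimes> v\<^sub>n\<close> in \<open>iota v\<^sub>n\<close> is nonzero, so the first component alone
  fixes the eigenvalue on \<open>v\<^sub>n\<close>. The scalar identity obtained in this way is
  \<open>C_coeff_recursion\<close>; after cancelling common factors it is the addition theorem \<open>sinh_exchange\<close>.
  The lowest vector \<open>v\<^bsub>d+2\<^esub>\<close> has only a second component, and there \<open>R\<close> acts as the identity, so its
  eigenvalue is a product of two eigenvalues (\<open>C_coeff_fuse\<close>).

  All this holds for spectral parameters outside a countable set, where no denominator vanishes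
  and all prescribed identities are valid. Since the entries of the K-operators are meromorphic and
  normalised, and the complement of a countable set accumulates everywhere, the formula extends
  to every point at which its right-hand side is regular.
\<close>

section \<open>Coordinates\<close>

abbreviation coord :: "'b vec \<Rightarrow> 'b \<Rightarrow> complex" where
  "coord \<equiv> Poly_Mapping.lookup"

lemma coord_smul [simp]: "coord (c \<cdot> u) b = c * coord u b"
  by (simp add: smul_def Poly_Mapping.map.rep_eq when_def)

lemma coord_bvec: "coord (bvec b) b' = (if b' = b then 1 else 0)"
  by (simp add: bvec_def lookup_single when_def)

lemma in_span_of_iff: "u \<in> span_of B \<longleftrightarrow> (\<forall>b. coord u b \<noteq> 0 \<longrightarrow> b \<in> B)"
  by (auto simp: span_of_def in_keys_iff)

lemma coord_outside_span: "u \<in> span_of B \<Longrightarrow> b \<notin> B \<Longrightarrow> coord u b = 0"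
  by (auto simp: in_span_of_iff)

lemma bvec_in_span_of: "b \<in> B \<Longrightarrow> bvec b \<in> span_of B"
  by (simp add: in_span_of_iff coord_bvec)

lemma zero_in_span_of: "0 \<in> span_of B"
  by (simp add: in_span_of_iff)

lemma add_in_span_of: "u \<in> span_of B \<Longrightarrow> w \<in> span_of B \<Longrightarrow> u + w \<in> span_of B"
  using Poly_Mapping.keys_add[of u w] by (auto simp: span_of_def)

lemma smul_in_span_of: "u \<in> span_of B \<Longrightarrow> c \<cdot> u \<in> span_of B"
  by (auto simp: in_span_of_iff)

lemma smul_simps [simp]: "0 \<cdot> u = 0" "c \<cdot> (0 :: 'b vec) = 0" "1 \<cdot> u = u"
  by (rule poly_mapping_eqI, simp)+

lemma smul_smul: "c \<cdot> (d \<cdot> u) = (c * d) \<cdot> u"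
  by (rule poly_mapping_eqI) simp

lemma coord_lin_ext:
  assumes "finite B" "Poly_Mapping.keys u \<subseteq> B"
  shows "coord (lin_ext A u) c = (\<Sum>b\<in>B. coord u b * coord (A b) c)"
  unfolding lin_ext_def lookup_sum coord_smul
  by (rule sum.mono_neutral_left) (use assms in \<open>auto simp: in_keys_iff\<close>)

lemma lin_ext_add: "lin_ext A (u + w) = lin_ext A u + lin_ext A w"
proof (rule poly_mapping_eqI)
  fix c
  let ?B = "Poly_Mapping.keys u \<union> Poly_Mapping.keys w"
  have "coord (lin_ext A (u + w)) c = (\<Sum>b\<in>?B. coord (u + w) b * coord (A b) c)"
    by (rule coord_lin_ext) (simp_all add: Poly_Mapping.keys_add)
  also have "\<dots> = (\<Sum>b\<in>?B. coord u b * coord (A b) c) + (\<Sum>b\<in>?B. coord w b * coord (A b) c)"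
    by (simp add: lookup_add algebra_simps sum.distrib)
  also have "\<dots> = coord (lin_ext A u + lin_ext A w) c"
    by (simp add: coord_lin_ext[of ?B] lookup_add)
  finally show "coord (lin_ext A (u + w)) c = coord (lin_ext A u + lin_ext A w) c" .
qed

lemma lin_ext_smul: "lin_ext A (c \<cdot> u) = c \<cdot> lin_ext A u"
proof (rule poly_mapping_eqI)
  fix b
  have "Poly_Mapping.keys (c \<cdot> u) \<subseteq> Poly_Mapping.keys u"
    by (auto simp: in_keys_iff)
  then show "coord (lin_ext A (c \<cdot> u)) b = coord (c \<cdot> lin_ext A u) b"
    by (simp add: coord_lin_ext[of "Poly_Mapping.keys u"] sum_distrib_left mult.assoc)
qed

lemma lin_ext_zero [simp]: "lin_ext A 0 = 0"
  by (simp add: lin_ext_def)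

lemma lin_ext_bvec [simp]: "lin_ext A (bvec b) = A b"
  by (simp add: lin_ext_def bvec_def)

lemma coord_tens [simp]: "coord (u \<otimes>\<^sub>v w) (b, c) = coord u b * coord w c"
proof -
  have "coord (u \<otimes>\<^sub>v w) (b, c) =
      (\<Sum>b'\<in>Poly_Mapping.keys u. \<Sum>c'\<in>Poly_Mapping.keys w.
        if b' = b then (if c' = c then coord u b * coord w c else 0) else 0)"
    unfolding tens_def lookup_sum
    by (intro sum.cong) (auto simp: lookup_single when_def)
  also have "\<dots> = (\<Sum>b'\<in>Poly_Mapping.keys u. if b' = b then
        (\<Sum>c'\<in>Poly_Mapping.keys w. if c' = c then coord u b * coord w c else 0) else 0)"
    by (intro sum.cong refl) auto
  also have "\<dots> = coord u b * coord w c"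
    by (simp add: in_keys_iff)
  finally show ?thesis .
qed

lemma tens_simps:
  "0 \<otimes>\<^sub>v w = 0" "u \<otimes>\<^sub>v 0 = 0" "(c \<cdot> u) \<otimes>\<^sub>v w = c \<cdot> (u \<otimes>\<^sub>v w)" "u \<otimes>\<^sub>v (c \<cdot> w) = c \<cdot> (u \<otimes>\<^sub>v w)"
  by (rule poly_mapping_eqI, auto)+

lemma bvec_tens_bvec: "bvec b \<otimes>\<^sub>v bvec c = bvec (b, c)"
  by (rule poly_mapping_eqI) (auto simp: coord_bvec split: if_splits)

lemma tens_op_bvec: "(S \<otimes>\<^sub>o T) (bvec (b, c)) = S (bvec b) \<otimes>\<^sub>v T (bvec c)"
  by (simp add: tens_op_def)

lemma coord_perm_op: "coord (perm_op u) (c, b) = coord u (b, c)"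
proof -
  have "coord (perm_op u) (c, b) =
      (\<Sum>x\<in>Poly_Mapping.keys u. if x = (b, c) then coord u (b, c) else 0)"
    unfolding perm_op_def coord_lin_ext[OF finite_keys subset_refl]
    by (intro sum.cong refl) (auto simp: coord_bvec split: if_splits)
  then show ?thesis
    by (simp add: in_keys_iff)
qed

text \<open>
  Lowering maps, diagonal maps and projections to a basis segment have at most one nonzero entry
  in each row. For such factors a coordinate of the image is a multiple of a single coordinate of
  the argument. Only rows restricted to \<open>B\<close> and \<open>C\<close> are constrained, because an operator on a
  module may take arbitrary values on labels outside the index set of that module.
\<close>

lemma coord_tens_op:
  assumes u: "u \<in> span_of (B \<times> C)"
    and S: "\<And>b. b \<in> B \<Longrightarrow> coord (S (bvec b)) i = (if b = i' then s else 0)"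
    and T: "\<And>c. c \<in> C \<Longrightarrow> coord (T (bvec c)) j = (if c = j' then t else 0)"
  shows "coord ((S \<otimes>\<^sub>o T) u) (i, j) = s * t * coord u (i', j')"
proof -
  have "coord ((S \<otimes>\<^sub>o T) u) (i, j) =
      (\<Sum>x\<in>Poly_Mapping.keys u. if x = (i', j') then s * t * coord u (i', j') else 0)"
    unfolding tens_op_def coord_lin_ext[OF finite_keys subset_refl]
    by (intro sum.cong refl) (use u in \<open>auto simp: S T span_of_def subset_iff split: if_splits\<close>)
  then show ?thesis
    by (simp add: in_keys_iff)
qed

lemma linear_op_combination:
  assumes "linear_op B C T" "u \<in> span_of B" "w \<in> span_of B"
  shows "T (a \<cdot> u + b \<cdot> w) = a \<cdot> T u + b \<cdot> T w"
  using assms by (simp add: linear_op_def smul_in_span_of)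

lemma linear_op_zero: "linear_op B C T \<Longrightarrow> T 0 = 0"
  unfolding linear_op_def by (metis smul_simps(1) zero_in_span_of)

section \<open>The intertwining relations on the Verma-type modules\<close>

definition weight :: "complex \<Rightarrow> complex \<Rightarrow> nat \<Rightarrow> complex" where
  "weight \<eta> l n = exp (2 * \<eta> * (l + 1 - of_nat n))"

lemma pi_x_bvec:
  assumes "n \<in> M_ix"
  shows "pi_x \<eta> l x (Gen (q_f N1)) (bvec n) = exp x \<cdot> bvec (Suc n)"
    and "pi_x \<eta> l x (Gen (q_e N0)) (bvec n) = exp (- x) \<cdot> bvec (Suc n)"
    and "pi_x \<eta> l x (Gen (q_ph (coroot N1))) (bvec n) = weight \<eta> l n \<cdot> bvec n"
    and "pi_x \<eta> l x (Gen (q_ph (- coroot N0))) (bvec n) = weight \<eta> l n \<cdot> bvec n"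
    and "pi_x \<eta> l x 1 (bvec n) = bvec n"
  using assms
  by (simp_all add: pi_x_def pi_rep_def phi_gen_def pi_gen_def times_fexpr_def one_fexpr_def
      mvec_def coroot_def weight_def pw_def M_ix_def mult_ac)

text \<open>
  The row form of the preceding facts. For \<open>i = 1\<close> the index \<open>i - 1\<close> is the label 0, which is
  not in the module, so the first row of a lowering map vanishes on the module.
\<close>

lemma pi_x_row:
  assumes "i \<ge> 1" "n \<in> M_ix"
  shows "coord (pi_x \<eta> l x (Gen (q_f N1)) (bvec n)) i = (if n = i - 1 then exp x else 0)"
    and "coord (pi_x \<eta> l x (Gen (q_e N0)) (bvec n)) i = (if n = i - 1 then exp (- x) else 0)"
    and "coord (pi_x \<eta> l x (Gen (q_ph (coroot N1))) (bvec n)) i = (if n = i then weight \<eta> l i else 0)"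
    and "coord (pi_x \<eta> l x (Gen (q_ph (- coroot N0))) (bvec n)) i = (if n = i then weight \<eta> l i else 0)"
    and "coord (pi_x \<eta> l x 1 (bvec n)) i = (if n = i then 1 else 0)"
  using assms by (auto simp: pi_x_bvec coord_bvec)

lemma Uhat_represents: "\<exists>X\<in>Uhat \<eta>. a \<in> X"
proof
  show "a \<in> {(a, b). alg_cong (uhat_rel \<eta>) a b} `` {a}"
    by (simp add: alg_cong.refl)
  show "{(a, b). alg_cong (uhat_rel \<eta>) a b} `` {a} \<in> Uhat \<eta>"
    unfolding Uhat_def by (rule quotientI) simp
qed

text \<open>
  The intertwining relations for \<open>f\<^sub>1\<close> and for \<open>e\<^sub>0\<close>, read off at the coordinate \<open>(i, j)\<close>. Only the
  difference of the two spectral parameters enters \<open>R\<close>, so it suffices to take the second one to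
  be 0, which makes the factors \<open>exp y\<close> disappear.
\<close>

lemma verma_R_lowering:
  assumes R: "verma_R_operator \<eta> k l R"
  obtains S where "countable S"
    and "\<And>z m n i j. \<lbrakk>z \<notin> S; m \<ge> 1; n \<ge> 1; i \<ge> 1; j \<ge> 1\<rbrakk> \<Longrightarrow>
      exp z * weight \<eta> l n * coord (R z (bvec (Suc m, n))) (i, j) + coord (R z (bvec (m, Suc n))) (i, j) =
      weight \<eta> k i * coord (R z (bvec (m, n))) (i, j - 1) + exp z * coord (R z (bvec (m, n))) (i - 1, j)"
    and "\<And>z m n i j. \<lbrakk>z \<notin> S; m \<ge> 1; n \<ge> 1; i \<ge> 1; j \<ge> 1\<rbrakk> \<Longrightarrow>
      exp (- z) * coord (R z (bvec (Suc m, n))) (i, j) + weight \<eta> k m * coord (R z (bvec (m, Suc n))) (i, j) =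
      exp (- z) * weight \<eta> l j * coord (R z (bvec (m, n))) (i - 1, j) + coord (R z (bvec (m, n))) (i, j - 1)"
proof -
  let ?M = "M_ix \<times> M_ix"
  obtain S where S: "countable S" and inter: "\<And>x y a u. x - y \<notin> S \<Longrightarrow> u \<in> span_of ?M \<Longrightarrow>
      R (x - y) (tens_rep (pi_x \<eta> k x) (pi_x \<eta> l y) (coprod a) u)
      = tens_rep (pi_x \<eta> k x) (pi_x \<eta> l y) (coprod_op a) (R (x - y) u)"
    using R Uhat_represents unfolding verma_R_operator_def by metis
  have lin: "linear_op ?M ?M (R z)" for z
    using R by (simp add: verma_R_operator_def)
  have R_span: "R z u \<in> span_of ?M" if "u \<in> span_of ?M" for z u
    using lin that by (auto simp: linear_op_def)
  have lincomb: "R z (a \<cdot> bvec (m, n) + b \<cdot> bvec (m', n')) = a \<cdot> R z (bvec (m, n)) + b \<cdot> R z (bvec (m', n'))"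
    if "m \<ge> 1" "n \<ge> 1" "m' \<ge> 1" "n' \<ge> 1" for z a b m n m' n'
    by (rule linear_op_combination[OF lin]) (use that in \<open>auto intro!: bvec_in_span_of simp: M_ix_def\<close>)
  note defs = tens_rep_def coprod_gen_def coprod_op_def
  show ?thesis
  proof (rule that[OF S])
    fix z m n i j
    assume *: "z \<notin> S" "m \<ge> (1::nat)" "n \<ge> (1::nat)" "i \<ge> (1::nat)" "j \<ge> (1::nat)"
    have M: "m \<in> M_ix" "n \<in> M_ix" "bvec (m, n) \<in> span_of ?M"
      using * by (auto intro!: bvec_in_span_of simp: M_ix_def)
    let ?U = "R z (bvec (m, n))"
    note co = coord_tens_op[OF R_span[OF M(3)]]
    let ?f = "Gen (q_f N1)" and ?h = "Gen (q_ph (coroot N1))"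
    have c: "coord ((pi_x \<eta> k z ?h \<otimes>\<^sub>o pi_x \<eta> l 0 ?f) ?U) (i, j) = weight \<eta> k i * coord ?U (i, j - 1)"
      "coord ((pi_x \<eta> k z ?f \<otimes>\<^sub>o pi_x \<eta> l 0 1) ?U) (i, j) = exp z * coord ?U (i - 1, j)"
      using co[OF pi_x_row(3)[OF *(4)] pi_x_row(1)[OF *(5)]]
        co[OF pi_x_row(1)[OF *(4)] pi_x_row(5)[OF *(5)]] by simp_all
    have "R z (tens_rep (pi_x \<eta> k z) (pi_x \<eta> l 0) (coprod ?f) (bvec (m, n)))
      = tens_rep (pi_x \<eta> k z) (pi_x \<eta> l 0) (coprod_op ?f) ?U"
      using inter[of z 0 "bvec (m, n)" ?f] * M(3) by simp
    then have "R z ((exp z * weight \<eta> l n) \<cdot> bvec (Suc m, n) + 1 \<cdot> bvec (m, Suc n))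
      = (pi_x \<eta> k z ?h \<otimes>\<^sub>o pi_x \<eta> l 0 ?f) ?U + (pi_x \<eta> k z ?f \<otimes>\<^sub>o pi_x \<eta> l 0 1) ?U"
      using M by (simp add: defs tens_op_bvec pi_x_bvec tens_simps smul_smul bvec_tens_bvec mult.commute)
    then have "coord ((exp z * weight \<eta> l n) \<cdot> R z (bvec (Suc m, n)) + 1 \<cdot> R z (bvec (m, Suc n))) (i, j)
      = coord ((pi_x \<eta> k z ?h \<otimes>\<^sub>o pi_x \<eta> l 0 ?f) ?U + (pi_x \<eta> k z ?f \<otimes>\<^sub>o pi_x \<eta> l 0 1) ?U) (i, j)"
      using * by (subst (asm) lincomb) auto
    then show "exp z * weight \<eta> l n * coord (R z (bvec (Suc m, n))) (i, j) + coord (R z (bvec (m, Suc n))) (i, j) =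
      weight \<eta> k i * coord ?U (i, j - 1) + exp z * coord ?U (i - 1, j)"
      unfolding lookup_add c by simp
  next
    fix z m n i j
    assume *: "z \<notin> S" "m \<ge> (1::nat)" "n \<ge> (1::nat)" "i \<ge> (1::nat)" "j \<ge> (1::nat)"
    have M: "m \<in> M_ix" "n \<in> M_ix" "bvec (m, n) \<in> span_of ?M"
      using * by (auto intro!: bvec_in_span_of simp: M_ix_def)
    let ?U = "R z (bvec (m, n))"
    note co = coord_tens_op[OF R_span[OF M(3)]]
    let ?f = "Gen (q_e N0)" and ?h = "Gen (q_ph (- coroot N0))"
    have c: "coord ((pi_x \<eta> k z 1 \<otimes>\<^sub>o pi_x \<eta> l 0 ?f) ?U) (i, j) = coord ?U (i, j - 1)"
      "coord ((pi_x \<eta> k z ?f \<otimes>\<^sub>o pi_x \<eta> l 0 ?h) ?U) (i, j) = exp (- z) * weight \<eta> l j * coord ?U (i - 1, j)"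
      using co[OF pi_x_row(5)[OF *(4)] pi_x_row(2)[OF *(5)]]
        co[OF pi_x_row(2)[OF *(4)] pi_x_row(4)[OF *(5)]] by simp_all
    have "R z (tens_rep (pi_x \<eta> k z) (pi_x \<eta> l 0) (coprod ?f) (bvec (m, n)))
      = tens_rep (pi_x \<eta> k z) (pi_x \<eta> l 0) (coprod_op ?f) ?U"
      using inter[of z 0 "bvec (m, n)" ?f] * M(3) by simp
    then have "R z (exp (- z) \<cdot> bvec (Suc m, n) + weight \<eta> k m \<cdot> bvec (m, Suc n))
      = (pi_x \<eta> k z 1 \<otimes>\<^sub>o pi_x \<eta> l 0 ?f) ?U + (pi_x \<eta> k z ?f \<otimes>\<^sub>o pi_x \<eta> l 0 ?h) ?U"
      using M by (simp add: defs tens_op_bvec pi_x_bvec tens_simps smul_smul bvec_tens_bvec add.commute)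
    then have "coord (exp (- z) \<cdot> R z (bvec (Suc m, n)) + weight \<eta> k m \<cdot> R z (bvec (m, Suc n))) (i, j)
      = coord ((pi_x \<eta> k z 1 \<otimes>\<^sub>o pi_x \<eta> l 0 ?f) ?U + (pi_x \<eta> k z ?f \<otimes>\<^sub>o pi_x \<eta> l 0 ?h) ?U) (i, j)"
      using * by (subst (asm) lincomb) auto
    then show "exp (- z) * coord (R z (bvec (Suc m, n))) (i, j) + weight \<eta> k m * coord (R z (bvec (m, Suc n))) (i, j) =
      exp (- z) * weight \<eta> l j * coord ?U (i - 1, j) + coord ?U (i, j - 1)"
      unfolding lookup_add c by simp
  qed
qed

section \<open>Matrix entries of the R-operator when the first spin is one half\<close>

lemma countable_sinh_zeros: "countable {z :: complex. sinh z = 0}"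
proof (rule countable_subset)
  show "{z :: complex. sinh z = 0} \<subseteq> range (\<lambda>n :: int. of_real (of_int n * pi) * \<i>)"
  proof
    fix z :: complex
    assume "z \<in> {z. sinh z = 0}"
    then have "exp z * exp z = 1"
      by (auto simp: sinh_zero_iff)
    then have "exp (2 * z) = 1"
      by (simp add: exp_double power2_eq_square)
    then obtain n :: int where "Re (2 * z) = 0" "Im (2 * z) = of_int (2 * n) * pi"
      unfolding exp_eq_1 by blast
    then have "z = of_real (of_int n * pi) * \<i>"
      by (simp add: complex_eq_iff)
    then show "z \<in> range (\<lambda>n :: int. of_real (of_int n * pi) * \<i>)"
      by blast
  qed
qed simp

lemma countable_affine_preimage:
  fixes a b :: complex
  assumes "countable S" "a \<noteq> 0"
  shows "countable {x. a * x + b \<in> S}"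
proof (rule countable_image_inj_on[of "\<lambda>x. a * x + b"])
  show "countable ((\<lambda>x. a * x + b) ` {x. a * x + b \<in> S})"
    by (rule countable_subset[OF _ assms(1)]) auto
  show "inj_on (\<lambda>x. a * x + b) {x. a * x + b \<in> S}"
    using assms(2) by (auto simp: inj_on_def)
qed

lemma countable_affine_sinh_zeros:
  fixes a b :: complex
  assumes "a \<noteq> 0"
  shows "countable {x. sinh (a * x + b) = 0}"
  using countable_affine_preimage[OF countable_sinh_zeros assms, of b] by simp

text \<open>
  Cramer's rule for the pair of equations in \<open>verma_R_lowering\<close> with \<open>k = 1/2\<close> and \<open>m = 1\<close>, where
  \<open>V\<close> and \<open>U\<close> are coordinates of the images of \<open>m\<^sub>2 \<otimes> m\<^sub>n\<close> and \<open>m\<^sub>1 \<otimes> m\<^sub>n\<^sub>+\<^sub>1\<close>. The determinant is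
  \<open>exp (2\<theta>) - 1\<close> up to sign, and dividing by \<open>exp \<theta>\<close> turns it into a hyperbolic sine.
\<close>

lemma lowering_pair_solve:
  fixes z l \<eta> U V A B :: complex and n :: nat
  defines "\<theta> \<equiv> z + (l + 3/2 - of_nat n) * \<eta>"
  assumes 1: "exp z * weight \<eta> l n * V + U = A"
    and 2: "exp (- z) * V + exp \<eta> * U = B"
  shows "2 * sinh \<theta> * U = exp (\<theta> - \<eta>) * B - exp (- \<theta>) * A"
    and "2 * sinh \<theta> * V = exp (z - \<theta>) * (exp \<eta> * A - B)"
proof -
  have "exp z * weight \<eta> l n = exp (z + 2 * \<eta> * (l + 1 - of_nat n))"
    by (simp add: weight_def exp_add)
  also have "z + 2 * \<eta> * (l + 1 - of_nat n) = 2 * \<theta> - z - \<eta>"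
    by (simp add: \<theta>_def field_simps)
  finally have A: "A = exp (2 * \<theta> - z - \<eta>) * V + U"
    using 1 by simp
  define t q w where "t = exp \<theta>" "q = exp \<eta>" "w = exp z"
  have e: "exp (2 * \<theta> - z - \<eta>) = t * t / w / q" "exp (\<theta> - \<eta>) = t / q" "exp (- \<theta>) = 1 / t"
    "exp (z - \<theta>) = w / t" "exp \<eta> = q" "exp (- z) = 1 / w" "sinh \<theta> = (t - 1 / t) / 2"
    by (simp_all add: t_q_w_def exp_diff exp_minus sinh_field_def exp_double power2_eq_square inverse_eq_divide)
  have nz: "t \<noteq> 0" "q \<noteq> 0" "w \<noteq> 0"
    by (simp_all add: t_q_w_def)
  show "2 * sinh \<theta> * U = exp (\<theta> - \<eta>) * B - exp (- \<theta>) * A"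
    unfolding A 2[symmetric] e using nz by (simp add: field_simps)
  show "2 * sinh \<theta> * V = exp (z - \<theta>) * (exp \<eta> * A - B)"
    unfolding A 2[symmetric] e using nz by (simp add: field_simps)
qed

text \<open>
  Vectors \<open>m\<^sub>i \<otimes> m\<^sub>j\<close> with \<open>i \<ge> 3\<close> may occur in these images too, but the lowering maps never decrease
  the first label, so the coordinates with first label 1 and 2 satisfy a closed recursion. It
  preserves the property that only the weight of the argument occurs, and along the diagonal its
  factors \<open>sinh (\<theta> - \<eta>) / sinh \<theta>\<close> telescope, because increasing \<open>n\<close> by 1 decreases
  \<open>\<theta> = z + (l + 3/2 - n)\<eta>\<close> by \<open>\<eta>\<close>.
\<close>

lemma verma_R_spin_half:
  assumes R: "verma_R_operator \<eta> (1/2) l R"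
  obtains S where "countable S"
    and "\<And>z n j. z \<notin> S \<Longrightarrow> n \<ge> 1 \<Longrightarrow> coord (R z (bvec (1, n))) (1, j) =
      (if j = n then sinh (z + (l + 3/2 - of_nat n) * \<eta>) / sinh (z + (l + 1/2) * \<eta>) else 0)"
    and "\<And>z n j. z \<notin> S \<Longrightarrow> n \<ge> 1 \<Longrightarrow> coord (R z (bvec (2, n))) (1, j) =
      (if j = Suc n then exp ((of_nat n - 1/2 - l) * \<eta>) * sinh \<eta> / sinh (z + (l + 1/2) * \<eta>) else 0)"
    and "\<And>z n j. z \<notin> S \<Longrightarrow> n \<ge> 1 \<Longrightarrow> n \<noteq> Suc j \<Longrightarrow> coord (R z (bvec (1, n))) (2, j) = 0"
    and "\<And>z n j. z \<notin> S \<Longrightarrow> n \<ge> 1 \<Longrightarrow> coord (R z (bvec (2, n))) (2, j) =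
      (if j = n then sinh (z + (of_nat n - l - 1/2) * \<eta>) / sinh (z + (l + 1/2) * \<eta>) else 0)"
proof -
  let ?M = "M_ix \<times> M_ix"
  obtain S where S: "countable S"
    and F: "\<And>z m n i j. \<lbrakk>z \<notin> S; m \<ge> 1; n \<ge> 1; i \<ge> 1; j \<ge> 1\<rbrakk> \<Longrightarrow>
      exp z * weight \<eta> l n * coord (R z (bvec (Suc m, n))) (i, j) + coord (R z (bvec (m, Suc n))) (i, j) =
      weight \<eta> (1/2) i * coord (R z (bvec (m, n))) (i, j - 1) + exp z * coord (R z (bvec (m, n))) (i - 1, j)"
    and E: "\<And>z m n i j. \<lbrakk>z \<notin> S; m \<ge> 1; n \<ge> 1; i \<ge> 1; j \<ge> 1\<rbrakk> \<Longrightarrow>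
      exp (- z) * coord (R z (bvec (Suc m, n))) (i, j) + weight \<eta> (1/2) m * coord (R z (bvec (m, Suc n))) (i, j) =
      exp (- z) * weight \<eta> l j * coord (R z (bvec (m, n))) (i - 1, j) + coord (R z (bvec (m, n))) (i, j - 1)"
    using verma_R_lowering[OF R] by blast
  have zero: "coord (R z (bvec (m, n))) (i, j) = 0" if "m \<ge> 1" "n \<ge> 1" "i = 0 \<or> j = 0" for z m n i j
  proof -
    have "bvec (m, n) \<in> span_of ?M"
      by (rule bvec_in_span_of) (use that in \<open>simp add: M_ix_def\<close>)
    moreover have "linear_op ?M ?M (R z)"
      using R unfolding verma_R_operator_def by blast
    ultimately have "R z (bvec (m, n)) \<in> span_of ?M"
      unfolding linear_op_def by blast
    then show ?thesis
      by (rule coord_outside_span) (use that in \<open>auto simp: M_ix_def\<close>)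
  qed
  define \<theta> where "\<theta> z n = z + (l + 3/2 - of_nat n) * \<eta>" for z :: complex and n :: nat
  have \<theta>_Suc: "\<theta> z (Suc n) = \<theta> z n - \<eta>" for z n
    by (simp add: \<theta>_def algebra_simps)
  have \<theta>_1: "\<theta> z 1 = z + (l + 1/2) * \<eta>" for z
    by (simp add: \<theta>_def algebra_simps)
  define S' where "S' = S \<union> (\<Union>n. {z. sinh (\<theta> z n) = 0})"
  have S': "countable S'"
    unfolding S'_def \<theta>_def using S countable_affine_sinh_zeros[of 1] by simp
  have weight_half: "weight \<eta> (1/2) 1 = exp \<eta>" "weight \<eta> (1/2) 2 = exp (- \<eta>)"
    by (simp_all add: weight_def)
  \<comment> \<open>Coordinates with first label 1: both right-hand sides involve only \<open>m\<^sub>1 \<otimes> m\<^sub>j\<^sub>-\<^sub>1\<close>.\<close>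
  have solve1: "sinh (\<theta> z n) * coord (R z (bvec (1, Suc n))) (1, j)
        = sinh (\<theta> z n - \<eta>) * coord (R z (bvec (1, n))) (1, j - 1)"
      "sinh (\<theta> z n) * coord (R z (bvec (2, n))) (1, j)
        = exp ((of_nat n - 1/2 - l) * \<eta>) * sinh \<eta> * coord (R z (bvec (1, n))) (1, j - 1)"
    if "z \<notin> S'" "n \<ge> 1" "j \<ge> 1" for z n j
  proof -
    have f: "exp z * weight \<eta> l n * coord (R z (bvec (2, n))) (1, j) + coord (R z (bvec (1, Suc n))) (1, j)
        = exp \<eta> * coord (R z (bvec (1, n))) (1, j - 1)"
      using F[of z 1 n 1 j] that zero[of 1 n 0 j z] by (simp add: S'_def weight_half[unfolded numeral_2_eq_2 One_nat_def] numeral_2_eq_2)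
    have e: "exp (- z) * coord (R z (bvec (2, n))) (1, j) + exp \<eta> * coord (R z (bvec (1, Suc n))) (1, j)
        = coord (R z (bvec (1, n))) (1, j - 1)"
      using E[of z 1 n 1 j] that zero[of 1 n 0 j z] by (simp add: S'_def weight_half[unfolded numeral_2_eq_2 One_nat_def] numeral_2_eq_2)
    note sol = lowering_pair_solve[OF f e, folded \<theta>_def]
    show "sinh (\<theta> z n) * coord (R z (bvec (1, Suc n))) (1, j)
        = sinh (\<theta> z n - \<eta>) * coord (R z (bvec (1, n))) (1, j - 1)"
      using sol(1) by (simp add: sinh_field_def exp_diff exp_minus field_simps)
    have shift: "(of_nat n - 1/2 - l) * \<eta> = z - \<theta> z n + \<eta>"
      by (simp add: \<theta>_def field_simps)
    have "exp (z - \<theta> z n) * (exp \<eta> * exp \<eta> - 1) = 2 * exp ((of_nat n - 1/2 - l) * \<eta>) * sinh \<eta>"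
      unfolding shift by (simp add: sinh_field_def exp_add exp_diff exp_minus field_simps)
    moreover have "2 * sinh (\<theta> z n) * coord (R z (bvec (2, n))) (1, j)
        = exp (z - \<theta> z n) * (exp \<eta> * exp \<eta> - 1) * coord (R z (bvec (1, n))) (1, j - 1)"
      using sol(2) by (simp add: algebra_simps)
    ultimately show "sinh (\<theta> z n) * coord (R z (bvec (2, n))) (1, j)
        = exp ((of_nat n - 1/2 - l) * \<eta>) * sinh \<eta> * coord (R z (bvec (1, n))) (1, j - 1)"
      by simp
  qed
  \<comment> \<open>Coordinates with first label 2: for the image of \<open>m\<^sub>2 \<otimes> m\<^sub>n\<close> the contributions of \<open>m\<^sub>2 \<otimes> m\<^sub>j\<^sub>-\<^sub>1\<close>
    cancel, so that only coordinates with first label 1 remain.\<close>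
  have solve2: "2 * sinh (\<theta> z n) * coord (R z (bvec (1, Suc n))) (2, j)
        = (exp (\<theta> z n - \<eta>) - exp (- \<theta> z n) * exp (- \<eta>)) * coord (R z (bvec (1, n))) (2, j - 1)
          + (exp (\<theta> z n - \<eta>) * exp (- z) * weight \<eta> l j - exp (- \<theta> z n) * exp z) * coord (R z (bvec (1, n))) (1, j)"
      "sinh (\<theta> z n) * coord (R z (bvec (2, n))) (2, j)
        = exp (z - \<theta> z n) * (exp \<eta> * exp z - exp (- z) * weight \<eta> l j) / 2 * coord (R z (bvec (1, n))) (1, j)"
    if "z \<notin> S'" "n \<ge> 1" "j \<ge> 1" for z n j
  proof -
    have f: "exp z * weight \<eta> l n * coord (R z (bvec (2, n))) (2, j) + coord (R z (bvec (1, Suc n))) (2, j)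
        = exp (- \<eta>) * coord (R z (bvec (1, n))) (2, j - 1) + exp z * coord (R z (bvec (1, n))) (1, j)"
      using F[of z 1 n 2 j] that by (simp add: S'_def weight_half[unfolded numeral_2_eq_2 One_nat_def] numeral_2_eq_2)
    have e: "exp (- z) * coord (R z (bvec (2, n))) (2, j) + exp \<eta> * coord (R z (bvec (1, Suc n))) (2, j)
        = exp (- z) * weight \<eta> l j * coord (R z (bvec (1, n))) (1, j) + coord (R z (bvec (1, n))) (2, j - 1)"
      using E[of z 1 n 2 j] that by (simp add: S'_def weight_half[unfolded numeral_2_eq_2 One_nat_def] numeral_2_eq_2)
    note sol = lowering_pair_solve[OF f e, folded \<theta>_def]
    have cancel: "exp \<eta> * (exp (- \<eta>) * c) = c" for c
      by (simp add: exp_minus)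
    show "2 * sinh (\<theta> z n) * coord (R z (bvec (1, Suc n))) (2, j)
        = (exp (\<theta> z n - \<eta>) - exp (- \<theta> z n) * exp (- \<eta>)) * coord (R z (bvec (1, n))) (2, j - 1)
          + (exp (\<theta> z n - \<eta>) * exp (- z) * weight \<eta> l j - exp (- \<theta> z n) * exp z) * coord (R z (bvec (1, n))) (1, j)"
      unfolding sol(1) by (simp add: algebra_simps)
    show "sinh (\<theta> z n) * coord (R z (bvec (2, n))) (2, j)
        = exp (z - \<theta> z n) * (exp \<eta> * exp z - exp (- z) * weight \<eta> l j) / 2 * coord (R z (bvec (1, n))) (1, j)"
      using sol(2) cancel by (simp add: algebra_simps)
  qed
  have start: "R z (bvec (1, 1)) = bvec (1, 1)" for z
    using R by (simp add: verma_R_operator_def mvec_def bvec_tens_bvec)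
  have a: "coord (R z (bvec (1, n))) (1, j) = (if j = n then sinh (\<theta> z n) / sinh (\<theta> z 1) else 0)"
    if z: "z \<notin> S'" and "n \<ge> 1" for z n j
    using that(2)
  proof (induction n arbitrary: j rule: dec_induct)
    case base
    show ?case
      using z by (auto simp: start[unfolded One_nat_def] coord_bvec S'_def)
  next
    case (step n)
    show ?case
    proof (cases "j = 0")
      case True
      then show ?thesis
        by (simp add: zero)
    next
      case False
      then have "sinh (\<theta> z n) * coord (R z (bvec (1, Suc n))) (1, j)
          = sinh (\<theta> z (Suc n)) * coord (R z (bvec (1, n))) (1, j - 1)"
        unfolding \<theta>_Suc by (intro solve1(1) z step.hyps) simp
      also have "\<dots> = sinh (\<theta> z n) * (if j = Suc n then sinh (\<theta> z (Suc n)) / sinh (\<theta> z 1) else 0)"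
        using False unfolding step.IH by auto
      finally show ?thesis
        using z by (simp add: S'_def)
    qed
  qed
  have b: "coord (R z (bvec (2, n))) (1, j) =
      (if j = Suc n then exp ((of_nat n - 1/2 - l) * \<eta>) * sinh \<eta> / sinh (\<theta> z 1) else 0)"
    if "z \<notin> S'" "n \<ge> 1" for z n j
  proof (cases "j = 0")
    case True
    then show ?thesis
      using that by (simp add: zero)
  next
    case False
    then have "sinh (\<theta> z n) * coord (R z (bvec (2, n))) (1, j)
        = exp ((of_nat n - 1/2 - l) * \<eta>) * sinh \<eta> * coord (R z (bvec (1, n))) (1, j - 1)"
      by (intro solve1(2) that) simp
    also have "\<dots> = sinh (\<theta> z n) *
        (if j = Suc n then exp ((of_nat n - 1/2 - l) * \<eta>) * sinh \<eta> / sinh (\<theta> z 1) else 0)"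
      using False unfolding a[OF that] by auto
    finally show ?thesis
      using that by (simp add: S'_def)
  qed
  have c: "coord (R z (bvec (1, n))) (2, j) = 0" if z: "z \<notin> S'" and "n \<ge> 1" "n \<noteq> Suc j" for z n j
    using that(2,3)
  proof (induction n arbitrary: j rule: dec_induct)
    case base
    show ?case
      by (simp add: start[unfolded One_nat_def] coord_bvec)
  next
    case (step n)
    show ?case
    proof (cases "j = 0")
      case True
      then show ?thesis
        by (simp add: zero)
    next
      case False
      then have "coord (R z (bvec (1, n))) (2, j - 1) = 0"
        using step by simp
      then show ?thesis
        using solve2(1)[of z n j] a[of z n j] step z False by (auto simp: S'_def)
    qed
  qed
  have d: "coord (R z (bvec (2, n))) (2, j) =
      (if j = n then sinh (z + (of_nat n - l - 1/2) * \<eta>) / sinh (\<theta> z 1) else 0)"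
    if z: "z \<notin> S'" and "n \<ge> 1" for z n j
  proof (cases "j = 0")
    case True
    then show ?thesis
      using that by (simp add: zero)
  next
    case False
    have "exp (z - \<theta> z n) * (exp \<eta> * exp z) = exp (z + (of_nat n - l - 1/2) * \<eta>)"
      unfolding exp_add[symmetric]
      by (rule arg_cong[where f = exp]) (simp add: \<theta>_def field_simps)
    moreover have "exp (z - \<theta> z n) * (exp (- z) * weight \<eta> l n) = exp (- (z + (of_nat n - l - 1/2) * \<eta>))"
      unfolding weight_def exp_add[symmetric]
      by (rule arg_cong[where f = exp]) (simp add: \<theta>_def field_simps)
    ultimately have diagonal: "exp (z - \<theta> z n) * (exp \<eta> * exp z - exp (- z) * weight \<eta> l n) / 2
        = sinh (z + (of_nat n - l - 1/2) * \<eta>)"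
      unfolding sinh_field_def right_diff_distrib by simp
    have "exp (z - \<theta> z n) * (exp \<eta> * exp z - exp (- z) * weight \<eta> l j) / 2 * coord (R z (bvec (1, n))) (1, j)
        = sinh (\<theta> z n) * (if j = n then sinh (z + (of_nat n - l - 1/2) * \<eta>) / sinh (\<theta> z 1) else 0)"
    proof (cases "j = n")
      case True
      show ?thesis
        unfolding True diagonal a[OF that] by simp
    qed (simp add: a[OF that, unfolded One_nat_def])
    then have "sinh (\<theta> z n) * coord (R z (bvec (2, n))) (2, j)
        = sinh (\<theta> z n) * (if j = n then sinh (z + (of_nat n - l - 1/2) * \<eta>) / sinh (\<theta> z 1) else 0)"
      using solve2(2)[OF that, of j] False by simp
    then show ?thesis
      using that by (simp add: S'_def)
  qed
  show ?thesis
    by (rule that[OF S' a[unfolded \<theta>_1, unfolded \<theta>_def] b[unfolded \<theta>_1] c d[unfolded \<theta>_1]])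
qed

lemma vvec_in: "n \<in> V_ix d \<Longrightarrow> vvec d n = bvec n"
  by (simp add: vvec_def mvec_def pr_def V_ix_def)

lemma vvec_out: "n \<notin> V_ix d \<Longrightarrow> vvec d n = 0"
  by (auto simp: vvec_def mvec_def pr_def)

lemma vvec_in_span_of: "vvec d n \<in> span_of (V_ix d)"
  by (cases "n \<in> V_ix d") (simp_all add: vvec_in vvec_out bvec_in_span_of zero_in_span_of)

lemma tens_vvec_in_span_of: "vvec c m \<otimes>\<^sub>v vvec d n \<in> span_of (V_ix c \<times> V_ix d)"
  by (cases "m \<in> V_ix c"; cases "n \<in> V_ix d")
    (simp_all add: vvec_in vvec_out tens_simps bvec_tens_bvec bvec_in_span_of zero_in_span_of)

lemma coord_pr_tens_pr:
  assumes "i \<in> V_ix c" "j \<in> V_ix d"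
  shows "coord ((pr c \<otimes>\<^sub>o pr d) u) (i, j) = coord u (i, j)"
  using coord_tens_op[of u UNIV UNIV "pr c" i i 1 "pr d" j j 1] assms
  by (auto simp: pr_def coord_bvec span_of_def)

text \<open>
  Projecting to the finite-dimensional quotients forgets coordinates but does not change the
  remaining ones, so \<open>R\<close> inherits its entries from the Verma-type modules.
\<close>

lemma R_spin_half:
  assumes "R_operator \<eta> 1 d R"
  obtains S where "countable S"
    and "\<And>z n j. \<lbrakk>z \<notin> S; n \<in> V_ix d; j \<in> V_ix d\<rbrakk> \<Longrightarrow> coord (R z (vvec 1 1 \<otimes>\<^sub>v vvec d n)) (1, j) =
      (if j = n then sinh (z + (of_nat d / 2 + 3/2 - of_nat n) * \<eta>) / sinh (z + (of_nat d / 2 + 1/2) * \<eta>) else 0)"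
    and "\<And>z n j. \<lbrakk>z \<notin> S; n \<in> V_ix d; j \<in> V_ix d\<rbrakk> \<Longrightarrow> coord (R z (vvec 1 2 \<otimes>\<^sub>v vvec d n)) (1, j) =
      (if j = Suc n then exp ((of_nat n - 1/2 - of_nat d / 2) * \<eta>) * sinh \<eta> / sinh (z + (of_nat d / 2 + 1/2) * \<eta>) else 0)"
    and "\<And>z n j. \<lbrakk>z \<notin> S; n \<in> V_ix d; j \<in> V_ix d; n \<noteq> Suc j\<rbrakk> \<Longrightarrow> coord (R z (vvec 1 1 \<otimes>\<^sub>v vvec d n)) (2, j) = 0"
    and "\<And>z n j. \<lbrakk>z \<notin> S; n \<in> V_ix d; j \<in> V_ix d\<rbrakk> \<Longrightarrow> coord (R z (vvec 1 2 \<otimes>\<^sub>v vvec d n)) (2, j) =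
      (if j = n then sinh (z + (of_nat n - of_nat d / 2 - 1/2) * \<eta>) / sinh (z + (of_nat d / 2 + 1/2) * \<eta>) else 0)"
proof -
  let ?M = "M_ix \<times> M_ix"
  obtain RM S where RM: "verma_R_operator \<eta> (1/2) (of_nat d / 2) RM" and S: "countable S"
    and pr_R: "\<And>z u. z \<notin> S \<Longrightarrow> u \<in> span_of ?M \<Longrightarrow> (pr 1 \<otimes>\<^sub>o pr d) (RM z u) = R z ((pr 1 \<otimes>\<^sub>o pr d) u)"
    using assms unfolding R_operator_def by (auto simp del: One_nat_def)
  obtain S' where S': "countable S'"
    and entries: "\<And>z n j. z \<notin> S' \<Longrightarrow> n \<ge> 1 \<Longrightarrow> coord (RM z (bvec (1, n))) (1, j) =
      (if j = n then sinh (z + (of_nat d / 2 + 3/2 - of_nat n) * \<eta>) / sinh (z + (of_nat d / 2 + 1/2) * \<eta>) else 0)"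
    "\<And>z n j. z \<notin> S' \<Longrightarrow> n \<ge> 1 \<Longrightarrow> coord (RM z (bvec (2, n))) (1, j) =
      (if j = Suc n then exp ((of_nat n - 1/2 - of_nat d / 2) * \<eta>) * sinh \<eta> / sinh (z + (of_nat d / 2 + 1/2) * \<eta>) else 0)"
    "\<And>z n j. z \<notin> S' \<Longrightarrow> n \<ge> 1 \<Longrightarrow> n \<noteq> Suc j \<Longrightarrow> coord (RM z (bvec (1, n))) (2, j) = 0"
    "\<And>z n j. z \<notin> S' \<Longrightarrow> n \<ge> 1 \<Longrightarrow> coord (RM z (bvec (2, n))) (2, j) =
      (if j = n then sinh (z + (of_nat n - of_nat d / 2 - 1/2) * \<eta>) / sinh (z + (of_nat d / 2 + 1/2) * \<eta>) else 0)"
    using verma_R_spin_half[OF RM] by blast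
  have descend: "coord (R z (vvec 1 i \<otimes>\<^sub>v vvec d n)) (i', j) = coord (RM z (bvec (i, n))) (i', j)"
    if "z \<notin> S" "i \<in> V_ix 1" "n \<in> V_ix d" "i' \<in> V_ix 1" "j \<in> V_ix d" for z i n i' j
  proof -
    have "(pr 1 \<otimes>\<^sub>o pr d) (bvec (i, n)) = vvec 1 i \<otimes>\<^sub>v vvec d n"
      using that by (simp add: tens_op_bvec vvec_in) (simp add: pr_def)
    moreover have "bvec (i, n) \<in> span_of ?M"
      by (rule bvec_in_span_of) (use that in \<open>auto simp: V_ix_def M_ix_def\<close>)
    ultimately have "R z (vvec 1 i \<otimes>\<^sub>v vvec d n) = (pr 1 \<otimes>\<^sub>o pr d) (RM z (bvec (i, n)))"
      using pr_R that(1) by simp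
    then show ?thesis
      using that by (simp only: coord_pr_tens_pr)
  qed
  have ix: "1 \<in> V_ix 1" "2 \<in> V_ix 1" "n \<in> V_ix d \<Longrightarrow> n \<ge> 1" for n
    by (auto simp: V_ix_def)
  show ?thesis
  proof (rule that[of "S \<union> S'"])
    show "countable (S \<union> S')"
      using S S' by simp
  qed (simp_all only: Un_iff de_Morgan_disj descend ix entries not_False_eq_True simp_thms)
qed

section \<open>The coefficients of the K-operators\<close>

lemma C_coeff_1 [simp]: "C_coeff \<eta> l (Suc 0) x \<xi> = 1"
  by (simp add: C_coeff_def)

lemma C_coeff_Suc:
  assumes "n \<ge> 1"
  shows "C_coeff \<eta> l (Suc n) x \<xi> = C_coeff \<eta> l n x \<xi> *
    (sinh (\<xi> - x + (l + 1/2 - of_nat n) * \<eta>) / sinh (\<xi> + x + (l + 1/2 - of_nat n) * \<eta>))"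
proof -
  obtain m where "n = Suc m"
    using assms by (cases n) auto
  then show ?thesis
    by (simp add: C_coeff_def)
qed

text \<open>
  The shift of the spectral parameter by \<open>\<eta>/2\<close> leaves the denominators of spin \<open>l\<close> aligned with those
  of spin \<open>l + 1/2\<close>, while the numerators move by one step. Hence the two products differ by a
  single numerator at the front and a single denominator at the end.
\<close>

lemma C_coeff_fuse:
  assumes "n \<ge> 1"
  shows "C_coeff \<eta> (l + 1/2) (Suc n) x \<xi> = C_coeff \<eta> l n (x + \<eta> / 2) \<xi> *
    (sinh (\<xi> - x + l * \<eta>) / sinh (\<xi> + x + (l + 1 - of_nat n) * \<eta>))"
  using assms
proof (induction n rule: dec_induct)
  case base
  then show ?case
    by (simp add: C_coeff_def)
next
  case (step n)
  have shift: "\<xi> - x + (l + 1/2 + 1/2 - of_nat (Suc n)) * \<eta> = \<xi> - (x + \<eta> / 2) + (l + 1/2 - of_nat n) * \<eta>"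
    "\<xi> + x + (l + 1/2 + 1/2 - of_nat (Suc n)) * \<eta> = \<xi> + x + (l + 1 - of_nat (Suc n)) * \<eta>"
    "\<xi> + (x + \<eta> / 2) + (l + 1/2 - of_nat n) * \<eta> = \<xi> + x + (l + 1 - of_nat n) * \<eta>"
    by (simp_all add: field_simps)
  have "C_coeff \<eta> (l + 1/2) (Suc (Suc n)) x \<xi> = C_coeff \<eta> (l + 1/2) (Suc n) x \<xi> *
    (sinh (\<xi> - x + (l + 1/2 + 1/2 - of_nat (Suc n)) * \<eta>) / sinh (\<xi> + x + (l + 1/2 + 1/2 - of_nat (Suc n)) * \<eta>))"
    by (rule C_coeff_Suc) simp
  also have "\<dots> = C_coeff \<eta> l (Suc n) (x + \<eta> / 2) \<xi> *
    (sinh (\<xi> - x + l * \<eta>) / sinh (\<xi> + x + (l + 1 - of_nat (Suc n)) * \<eta>))"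
    unfolding C_coeff_Suc[OF step.hyps(1), of \<eta> l] shift step.IH by simp
  finally show ?case .
qed

lemma sinh_exchange:
  "sinh u * sinh y = sinh (u - m) * sinh (y - m) + sinh m * sinh (u + y - m)" for u y m :: complex
proof -
  define a b c where "a = exp u" "b = exp y" "c = exp m"
  have e: "sinh u = (a - 1/a) / 2" "sinh y = (b - 1/b) / 2" "sinh m = (c - 1/c) / 2"
    "sinh (u - m) = (a/c - c/a) / 2" "sinh (y - m) = (b/c - c/b) / 2"
    "sinh (u + y - m) = (a*b/c - c/(a*b)) / 2"
    by (simp_all add: a_b_c_def sinh_field_def exp_diff exp_minus exp_add inverse_eq_divide divide_simps)
  have "a \<noteq> 0" "b \<noteq> 0" "c \<noteq> 0"
    by (simp_all add: a_b_c_def)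
  then show ?thesis
    unfolding e by (simp add: field_simps)
qed

text \<open>
  The first component of the fusion recursion at weight \<open>n + 1\<close>. Taking out the common factor
  \<open>C_coeff \<eta> l n (x + \<eta>/2) \<xi>\<close> leaves \<open>sinh_exchange\<close> with \<open>u = \<xi> - x + l\<eta>\<close>, \<open>y = 2x + \<eta>\<close>, \<open>m = n\<eta>\<close>.
\<close>

lemma C_coeff_recursion:
  fixes l x \<xi> \<eta> :: complex
  assumes n: "n \<ge> 1" and y: "sinh (2 * x + \<eta>) \<noteq> 0"
    and den: "sinh (\<xi> + x + (l + 1 - of_nat n) * \<eta>) \<noteq> 0"
  shows "C_coeff \<eta> (l + 1/2) (Suc n) x \<xi> * sinh (2 * x + \<eta>) =
    C_coeff \<eta> l (Suc n) (x + \<eta> / 2) \<xi> * sinh (2 * x + (1 - of_nat n) * \<eta>)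
    + C_coeff \<eta> l n (x + \<eta> / 2) \<xi> * sinh (of_nat n * \<eta>)"
proof -
  define f g where "f = sinh (\<xi> - x + l * \<eta> - of_nat n * \<eta>)" "g = sinh (\<xi> + x + (l + 1 - of_nat n) * \<eta>)"
  have shift: "\<xi> - (x + \<eta> / 2) + (l + 1/2 - of_nat n) * \<eta> = \<xi> - x + l * \<eta> - of_nat n * \<eta>"
    "\<xi> + (x + \<eta> / 2) + (l + 1/2 - of_nat n) * \<eta> = \<xi> + x + (l + 1 - of_nat n) * \<eta>"
    "2 * x + (1 - of_nat n) * \<eta> = 2 * x + \<eta> - of_nat n * \<eta>"
    "\<xi> - x + l * \<eta> + (2 * x + \<eta>) - of_nat n * \<eta> = \<xi> + x + (l + 1 - of_nat n) * \<eta>"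
    by (simp_all add: field_simps)
  have exchange: "sinh (\<xi> - x + l * \<eta>) * sinh (2 * x + \<eta>) =
      f * sinh (2 * x + (1 - of_nat n) * \<eta>) + sinh (of_nat n * \<eta>) * g"
    using sinh_exchange[of "\<xi> - x + l * \<eta>" "2 * x + \<eta>" "of_nat n * \<eta>"]
    unfolding f_g_def shift .
  have "g \<noteq> 0"
    using den by (simp add: f_g_def)
  have "c * (sinh (\<xi> - x + l * \<eta>) / g) * sinh (2 * x + \<eta>) =
      c * (f / g) * sinh (2 * x + (1 - of_nat n) * \<eta>) + c * sinh (of_nat n * \<eta>)" for c
  proof -
    have "c * (sinh (\<xi> - x + l * \<eta>) / g) * sinh (2 * x + \<eta>) =
        c / g * (sinh (\<xi> - x + l * \<eta>) * sinh (2 * x + \<eta>))"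
      by simp
    then show ?thesis
      unfolding exchange using \<open>g \<noteq> 0\<close> by (simp add: field_simps)
  qed
  then show ?thesis
    unfolding C_coeff_fuse[OF n] C_coeff_Suc[OF n, of \<eta> l] shift(1,2) f_g_def[symmetric] .
qed

section \<open>The fusion step\<close>

definition iota_coeff1 :: "complex \<Rightarrow> nat \<Rightarrow> complex" where
  "iota_coeff1 \<eta> n = exp (\<eta> / 2 * (of_nat n - 1))"

definition iota_coeff2 :: "complex \<Rightarrow> nat \<Rightarrow> nat \<Rightarrow> complex" where
  "iota_coeff2 \<eta> d n = exp (- (\<eta> / 2) * (of_nat n - 2 - of_nat d)) * sinh ((of_nat n - 1) * \<eta>) / sinh \<eta>"

lemma iota_bvec:
  "iota \<eta> d (bvec n) = iota_coeff1 \<eta> n \<cdot> (vvec 1 1 \<otimes>\<^sub>v vvec d n) + iota_coeff2 \<eta> d n \<cdot> (vvec 1 2 \<otimes>\<^sub>v vvec d (n - 1))"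
  by (simp add: iota_def iota_coeff1_def iota_coeff2_def)

lemma coord_iota:
  assumes "m \<in> V_ix d"
  shows "coord (iota \<eta> d u) (1, m) = iota_coeff1 \<eta> m * coord u m"
    and "coord (iota \<eta> d u) (2, m) = iota_coeff2 \<eta> d (Suc m) * coord u (Suc m)"
proof -
  have v: "coord (vvec d n) m = (if n = m then 1 else 0)" for n
    using assms by (cases "n \<in> V_ix d") (auto simp: vvec_in vvec_out coord_bvec)
  have ix: "1 \<in> V_ix 1" "2 \<in> V_ix 1"
    by (auto simp: V_ix_def)
  have m: "n - 1 = m \<longleftrightarrow> n = Suc m" for n
    using assms by (auto simp: V_ix_def)
  have "coord (iota \<eta> d u) (1, m) = (\<Sum>n\<in>Poly_Mapping.keys u. if n = m then iota_coeff1 \<eta> m * coord u m else 0)"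
    unfolding iota_def coord_lin_ext[OF finite_keys subset_refl]
    by (intro sum.cong refl) (auto simp: lookup_add vvec_in ix v coord_bvec iota_coeff1_def simp del: One_nat_def)
  then show "coord (iota \<eta> d u) (1, m) = iota_coeff1 \<eta> m * coord u m"
    by (simp add: in_keys_iff)
  have "coord (iota \<eta> d u) (2, m) =
      (\<Sum>n\<in>Poly_Mapping.keys u. if n = Suc m then iota_coeff2 \<eta> d (Suc m) * coord u (Suc m) else 0)"
    unfolding iota_def coord_lin_ext[OF finite_keys subset_refl]
    by (intro sum.cong refl) (auto simp: lookup_add vvec_in ix v m coord_bvec iota_coeff2_def simp del: One_nat_def)
  then show "coord (iota \<eta> d u) (2, m) = iota_coeff2 \<eta> d (Suc m) * coord u (Suc m)"
    by (simp add: in_keys_iff)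
qed

lemma sinh_multiple_nonzero:
  assumes generic: "\<And>m::nat. m > 0 \<Longrightarrow> exp \<eta> ^ m \<noteq> 1" and "m > 0"
  shows "sinh (of_nat m * \<eta> :: complex) \<noteq> 0"
proof
  assume "sinh (of_nat m * \<eta>) = 0"
  then have "exp (of_nat m * \<eta>) ^ 2 = 1"
    by (auto simp: sinh_zero_iff)
  then have "exp \<eta> ^ (m * 2) = 1"
    by (simp add: exp_of_nat_mult power_mult)
  with generic[of "m * 2"] \<open>m > 0\<close> show False
    by simp
qed

text \<open>
  The eigenvector equation is assumed only inside the index set: outside of it \<open>vvec d n\<close> is zero.
  This covers the boundary terms of \<open>iota\<close> without case distinctions.
\<close>

lemma tens_op_id_eigenvector:
  assumes "linear_op (V_ix d) (V_ix d) T"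
    and "n \<in> V_ix d \<Longrightarrow> T (vvec d n) = c \<cdot> vvec d n"
    and "m \<in> V_ix c'"
  shows "(id \<otimes>\<^sub>o T) (vvec c' m \<otimes>\<^sub>v vvec d n) = c \<cdot> (vvec c' m \<otimes>\<^sub>v vvec d n)"
proof (cases "n \<in> V_ix d")
  case True
  then show ?thesis
    using assms by (simp add: vvec_in bvec_tens_bvec tens_op_bvec tens_simps)
next
  case False
  then show ?thesis
    by (simp add: vvec_out tens_simps tens_op_def)
qed

text \<open>
  The vector \<open>iota v\<^sub>n\<close> has the two components \<open>v\<^sub>1 \<otimes> v\<^sub>n\<close> and \<open>v\<^sub>2 \<otimes> v\<^sub>n\<^sub>-\<^sub>1\<close>. The coordinate of \<open>K' x v\<^sub>n\<close> at
  \<open>m \<le> d + 1\<close> is read off from the component \<open>v\<^sub>1 \<otimes> v\<^sub>m\<close> and the one at \<open>m = d + 2\<close> from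
  \<open>v\<^sub>2 \<otimes> v\<^bsub>d+1\<^esub>\<close>. This choice of coordinates avoids the off-diagonal entry of \<open>R\<close> that leads from
  \<open>v\<^sub>1 \<otimes> v\<^sub>n\<close> to \<open>v\<^sub>2 \<otimes> v\<^sub>n\<^sub>-\<^sub>1\<close>. Genericity of \<open>\<eta>\<close> makes the
  coefficient of \<open>v\<^sub>2 \<otimes> v\<^bsub>d+1\<^esub>\<close> nonzero.
\<close>

lemma fusion_step:
  assumes generic: "\<And>m::nat. m > 0 \<Longrightarrow> exp \<eta> ^ m \<noteq> 1"
    and d: "d \<ge> 1"
    and R: "R_operator \<eta> 1 d R"
    and lin: "\<And>x. linear_op (V_ix d) (V_ix d) (K x)" "\<And>x. linear_op (V_ix (Suc d)) (V_ix (Suc d)) (K' x)"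
    and K1: "\<And>x. K1 x (vvec 1 1) = vvec 1 1"
      "\<And>x. sinh (\<xi> + x) \<noteq> 0 \<Longrightarrow> K1 x (vvec 1 2) = (sinh (\<xi> - x) / sinh (\<xi> + x)) \<cdot> vvec 1 2"
    and fusion: "countable {x. \<not> (\<forall>u\<in>span_of (V_ix (Suc d)). jmap \<eta> d (K' x u) =
        perm_op ((K1 (x - of_nat d / 2 * \<eta>) \<otimes>\<^sub>o id)
          (R (2 * x - (of_nat d / 2 - 1 / 2) * \<eta>)
            ((id \<otimes>\<^sub>o K (x + \<eta> / 2)) (iota \<eta> d u)))))}"
    and K: "countable {x. \<not> (\<forall>n\<in>V_ix d. K x (vvec d n) = C_coeff \<eta> (of_nat d / 2) n x \<xi> \<cdot> vvec d n)}"
  shows "countable {x. \<not> (\<forall>n\<in>V_ix (Suc d).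
      K' x (vvec (Suc d) n) = C_coeff \<eta> (of_nat (Suc d) / 2) n x \<xi> \<cdot> vvec (Suc d) n)}"
proof -
  define l :: complex where "l = of_nat d / 2"
  have l': "of_nat (Suc d) / 2 = l + 1/2"
    by (simp add: l_def field_simps)
  obtain S where S: "countable S"
    and entries: "\<And>z n j. \<lbrakk>z \<notin> S; n \<in> V_ix d; j \<in> V_ix d\<rbrakk> \<Longrightarrow> coord (R z (vvec 1 1 \<otimes>\<^sub>v vvec d n)) (1, j) =
      (if j = n then sinh (z + (l + 3/2 - of_nat n) * \<eta>) / sinh (z + (l + 1/2) * \<eta>) else 0)"
    "\<And>z n j. \<lbrakk>z \<notin> S; n \<in> V_ix d; j \<in> V_ix d\<rbrakk> \<Longrightarrow> coord (R z (vvec 1 2 \<otimes>\<^sub>v vvec d n)) (1, j) =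
      (if j = Suc n then exp ((of_nat n - 1/2 - l) * \<eta>) * sinh \<eta> / sinh (z + (l + 1/2) * \<eta>) else 0)"
    "\<And>z n j. \<lbrakk>z \<notin> S; n \<in> V_ix d; j \<in> V_ix d; n \<noteq> Suc j\<rbrakk> \<Longrightarrow> coord (R z (vvec 1 1 \<otimes>\<^sub>v vvec d n)) (2, j) = 0"
    "\<And>z n j. \<lbrakk>z \<notin> S; n \<in> V_ix d; j \<in> V_ix d\<rbrakk> \<Longrightarrow> coord (R z (vvec 1 2 \<otimes>\<^sub>v vvec d n)) (2, j) =
      (if j = n then sinh (z + (of_nat n - l - 1/2) * \<eta>) / sinh (z + (l + 1/2) * \<eta>) else 0)"
    unfolding l_def using R_spin_half[OF R] by blast
  let ?fusion = "\<lambda>x. \<forall>u\<in>span_of (V_ix (Suc d)). jmap \<eta> d (K' x u) =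
        perm_op ((K1 (x - of_nat d / 2 * \<eta>) \<otimes>\<^sub>o id)
          (R (2 * x - (of_nat d / 2 - 1 / 2) * \<eta>)
            ((id \<otimes>\<^sub>o K (x + \<eta> / 2)) (iota \<eta> d u))))"
  let ?IH = "\<lambda>x. \<forall>n\<in>V_ix d. K x (vvec d n) = C_coeff \<eta> l n x \<xi> \<cdot> vvec d n"
  \<comment> \<open>Outside \<open>E\<close> the recursion, the induction hypothesis and the formula for \<open>R\<close> apply at the shifted
    parameters, and no denominator vanishes.\<close>
  define E where "E = {x. \<not> ?fusion x} \<union> {x. 1 * x + \<eta> / 2 \<in> {x. \<not> ?IH x}}
    \<union> {x. 2 * x + (- (l - 1/2) * \<eta>) \<in> S} \<union> {x. sinh (2 * x + \<eta>) = 0}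
    \<union> (\<Union>n::nat. {x. sinh (1 * x + (\<xi> + (l + 1 - of_nat n) * \<eta>)) = 0})"
  have "countable {x. \<not> ?IH x}"
    using K by (simp only: l_def)
  then have "countable E"
    unfolding E_def using fusion S
    by (intro countable_Un countable_UN countable_affine_preimage countable_affine_sinh_zeros) simp_all
  moreover have "K' x (vvec (Suc d) n) = C_coeff \<eta> (of_nat (Suc d) / 2) n x \<xi> \<cdot> vvec (Suc d) n"
    if "x \<notin> E" and n: "n \<in> V_ix (Suc d)" for x n
  proof -
    define z where "z = 2 * x - (l - 1/2) * \<eta>"
    define c where "c n = C_coeff \<eta> l n (x + \<eta> / 2) \<xi>" for n
    define c' where "c' = C_coeff \<eta> (l + 1/2) n x \<xi>"
    define \<kappa> where "\<kappa> = sinh (\<xi> - (x - l * \<eta>)) / sinh (\<xi> + (x - l * \<eta>))"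
    have fus: "?fusion x" and IH: "?IH (x + \<eta> / 2)" and z: "z \<notin> S" and y: "sinh (2 * x + \<eta>) \<noteq> 0"
      and den: "sinh (\<xi> + x + (l + 1 - of_nat n) * \<eta>) \<noteq> 0" for n :: nat
      using that(1) by (simp_all add: E_def z_def algebra_simps)
    have y': "z + (l + 1/2) * \<eta> = 2 * x + \<eta>"
      by (simp add: z_def field_simps)
    have nz: "iota_coeff1 \<eta> m \<noteq> 0" for m
      by (simp add: iota_coeff1_def)
    have \<eta>: "sinh \<eta> \<noteq> 0"
      using sinh_multiple_nonzero[OF generic, of 1] by simp
    have n1: "n \<ge> 1"
      using n by (simp add: V_ix_def)
    define X Y where "X = vvec 1 1 \<otimes>\<^sub>v vvec d n" "Y = vvec 1 2 \<otimes>\<^sub>v vvec d (n - 1)"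
    have ix: "1 \<in> V_ix 1" "2 \<in> V_ix 1"
      by (auto simp: V_ix_def)
    have linR: "linear_op (V_ix 1 \<times> V_ix d) (V_ix 1 \<times> V_ix d) (R z)"
      using R unfolding R_operator_def by blast
    have "(id \<otimes>\<^sub>o K (x + \<eta> / 2)) (iota \<eta> d (vvec (Suc d) n))
        = (iota_coeff1 \<eta> n * c n) \<cdot> X + (iota_coeff2 \<eta> d n * c (n - 1)) \<cdot> Y"
    proof -
      have "(id \<otimes>\<^sub>o K (x + \<eta> / 2)) X = c n \<cdot> X" "(id \<otimes>\<^sub>o K (x + \<eta> / 2)) Y = c (n - 1) \<cdot> Y"
        unfolding X_Y_def c_def using IH by (intro tens_op_id_eigenvector lin ix; simp)+
      then show ?thesis
        unfolding vvec_in[OF n] iota_bvec X_Y_def[symmetric] tens_op_def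
        by (simp add: lin_ext_add lin_ext_smul smul_smul)
    qed
    moreover have "R z ((iota_coeff1 \<eta> n * c n) \<cdot> X + (iota_coeff2 \<eta> d n * c (n - 1)) \<cdot> Y)
        = (iota_coeff1 \<eta> n * c n) \<cdot> R z X + (iota_coeff2 \<eta> d n * c (n - 1)) \<cdot> R z Y"
      unfolding X_Y_def by (rule linear_op_combination[OF linR]) (rule tens_vvec_in_span_of)+
    moreover define W where "W = (iota_coeff1 \<eta> n * c n) \<cdot> R z X + (iota_coeff2 \<eta> d n * c (n - 1)) \<cdot> R z Y"
    ultimately have "jmap \<eta> d (K' x (vvec (Suc d) n)) = perm_op ((K1 (x - l * \<eta>) \<otimes>\<^sub>o id) W)"
      using fus vvec_in_span_of[of "Suc d" n] by (simp add: z_def l_def)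
    then have "coord (jmap \<eta> d (K' x (vvec (Suc d) n))) (j, i) = coord (perm_op ((K1 (x - l * \<eta>) \<otimes>\<^sub>o id) W)) (j, i)" for i j
      by simp
    then have main: "coord (iota \<eta> d (K' x (vvec (Suc d) n))) (i, j) = coord ((K1 (x - l * \<eta>) \<otimes>\<^sub>o id) W) (i, j)" for i j
      by (simp add: jmap_def coord_perm_op)
    have RX: "R z X \<in> span_of (V_ix 1 \<times> V_ix d)" "R z Y \<in> span_of (V_ix 1 \<times> V_ix d)"
      using linR tens_vvec_in_span_of unfolding linear_op_def X_Y_def by blast+
    then have W: "W \<in> span_of (V_ix 1 \<times> V_ix d)"
      unfolding W_def by (intro add_in_span_of smul_in_span_of)
    have den_K1: "sinh (\<xi> + (x - l * \<eta>)) \<noteq> 0"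
      using den[of "Suc d"] by (simp add: l_def field_simps)
    have K1b: "K1 (x - l * \<eta>) (bvec 1) = bvec 1" "K1 (x - l * \<eta>) (bvec 2) = \<kappa> \<cdot> bvec 2"
      using K1(1)[of "x - l * \<eta>"] K1(2)[OF den_K1]
      unfolding vvec_in[OF ix(1)] vvec_in[OF ix(2)] \<kappa>_def .
    have rows: "coord (K1 (x - l * \<eta>) (bvec b)) 1 = (if b = 1 then 1 else 0)"
      "coord (K1 (x - l * \<eta>) (bvec b)) 2 = (if b = 2 then \<kappa> else 0)" if "b \<in> V_ix 1" for b
    proof -
      have "b = 1 \<or> b = 2"
        using that by (auto simp: V_ix_def)
      then show "coord (K1 (x - l * \<eta>) (bvec b)) 1 = (if b = 1 then 1 else 0)"
        "coord (K1 (x - l * \<eta>) (bvec b)) 2 = (if b = 2 then \<kappa> else 0)"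
        using K1b by (auto simp: coord_bvec simp del: One_nat_def)
    qed
    have K1W: "coord ((K1 (x - l * \<eta>) \<otimes>\<^sub>o id) W) (1, j) = 1 * 1 * coord W (1, j)"
      "coord ((K1 (x - l * \<eta>) \<otimes>\<^sub>o id) W) (2, j) = \<kappa> * 1 * coord W (2, j)" for j
      by (rule coord_tens_op[OF W rows(1)] coord_tens_op[OF W rows(2)]; simp add: coord_bvec)+
    have R_zero: "R z 0 = 0"
      by (rule linear_op_zero[OF linR])
    have cases: "n = 1 \<or> (n \<ge> 2 \<and> n \<in> V_ix d) \<or> n = Suc (Suc d)"
      using n by (auto simp: V_ix_def)
    have W1: "coord W (1, m) = (if m = n then iota_coeff1 \<eta> n * c' else 0)" if m: "m \<in> V_ix d" for m
      using cases
    proof (elim disjE conjE)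
      assume "n = 1"
      then have "Y = 0" "n \<in> V_ix d"
        by (simp_all add: X_Y_def vvec_def mvec_def pr_def tens_simps V_ix_def)
      moreover have "z + (l + 3/2 - of_nat n) * \<eta> = 2 * x + \<eta>"
        by (simp add: \<open>n = 1\<close> z_def field_simps)
      ultimately have "coord (R z X) (1, m) = (if m = n then 1 else 0)"
        using entries(1)[OF z _ m, of n] y y' by (simp add: X_Y_def)
      then show ?thesis
        using \<open>n = 1\<close> \<open>Y = 0\<close> by (simp add: W_def lookup_add R_zero c_def c'_def)
    next
      assume "n = Suc (Suc d)"
      then have "X = 0" "n - 1 \<in> V_ix d" "m \<noteq> n"
        using m by (simp_all add: X_Y_def vvec_out tens_simps V_ix_def)
      then show ?thesis
        using entries(2)[OF z _ m, of "n - 1"] \<open>n = Suc (Suc d)\<close> by (simp add: W_def lookup_add R_zero X_Y_def)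
    next
      assume n2: "n \<ge> 2" and nd: "n \<in> V_ix d"
      then obtain p where p: "n = Suc p" "p \<ge> 1"
        by (cases n) auto
      have pd: "p \<in> V_ix d"
        using nd p by (simp add: V_ix_def)
      have rec: "c' * sinh (2 * x + \<eta>) = c n * sinh (2 * x + (1 - of_nat p) * \<eta>) + c p * sinh (of_nat p * \<eta>)"
        unfolding c_def c'_def p(1) using C_coeff_recursion[OF p(2) y den] .
      have coeff1: "iota_coeff1 \<eta> n = exp (- (\<eta> / 2) * (of_nat n - 2 - of_nat d)) * exp ((of_nat p - 1/2 - l) * \<eta>)"
        unfolding iota_coeff1_def exp_add[symmetric] by (rule arg_cong[where f = exp]) (simp add: p l_def field_simps)
      have coeff2: "iota_coeff2 \<eta> d n * (exp ((of_nat p - 1/2 - l) * \<eta>) * sinh \<eta>) = iota_coeff1 \<eta> n * sinh (of_nat p * \<eta>)"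
        unfolding coeff1 iota_coeff2_def using \<eta> by (simp add: p)
      have a: "z + (l + 3/2 - of_nat n) * \<eta> = 2 * x + (1 - of_nat p) * \<eta>"
        by (simp add: z_def p field_simps)
      show ?thesis
      proof (cases "m = n")
        case True
        have "coord W (1, m) = iota_coeff1 \<eta> n * c n * (sinh (2 * x + (1 - of_nat p) * \<eta>) / sinh (2 * x + \<eta>))
            + iota_coeff2 \<eta> d n * c p * (exp ((of_nat p - 1/2 - l) * \<eta>) * sinh \<eta> / sinh (2 * x + \<eta>))"
          using entries(1)[OF z nd m] entries(2)[OF z pd m] True
          unfolding y' a by (simp add: W_def lookup_add X_Y_def p)
        also have "\<dots> = (iota_coeff1 \<eta> n * c n * sinh (2 * x + (1 - of_nat p) * \<eta>)
            + c p * (iota_coeff2 \<eta> d n * (exp ((of_nat p - 1/2 - l) * \<eta>) * sinh \<eta>))) / sinh (2 * x + \<eta>)"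
          by (simp add: add_divide_distrib)
        also have "\<dots> = iota_coeff1 \<eta> n * (c n * sinh (2 * x + (1 - of_nat p) * \<eta>) + c p * sinh (of_nat p * \<eta>))
            / sinh (2 * x + \<eta>)"
          unfolding coeff2 by (simp add: algebra_simps)
        also have "\<dots> = iota_coeff1 \<eta> n * c'"
          unfolding rec[symmetric] using y by simp
        finally show ?thesis
          using True by simp
      next
        case False
        then show ?thesis
          using entries(1)[OF z nd m] entries(2)[OF z pd m] by (simp add: W_def lookup_add X_Y_def p)
      qed
    qed
    have top: "Suc d \<in> V_ix d"
      by (simp add: V_ix_def)
    have W2: "\<kappa> * coord W (2, Suc d) = (if n = Suc (Suc d) then iota_coeff2 \<eta> d n * c' else 0)"
    proof (cases "n = Suc (Suc d)")
      case True
      then have "X = 0"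
        by (simp add: X_Y_def vvec_out tens_simps V_ix_def)
      have "of_nat d = 2 * l"
        by (simp add: l_def)
      then have "z + (of_nat (Suc d) - l - 1/2) * \<eta> = 2 * x + \<eta>"
        by (simp add: z_def field_simps)
      then have "coord W (2, Suc d) = iota_coeff2 \<eta> d n * c (Suc d)"
        using entries(4)[OF z top top] True y \<open>X = 0\<close>
        unfolding y' by (simp add: W_def lookup_add R_zero X_Y_def del: of_nat_Suc)
      moreover have "c' = c (Suc d) * \<kappa>"
      proof -
        have shift: "\<xi> - x + l * \<eta> = \<xi> - (x - l * \<eta>)" "\<xi> + x + (l + 1 - of_nat (Suc d)) * \<eta> = \<xi> + (x - l * \<eta>)"
          by (simp_all add: l_def field_simps)
        have "1 \<le> Suc d"
          by simp
        show ?thesis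
          unfolding c'_def c_def \<kappa>_def True C_coeff_fuse[OF \<open>1 \<le> Suc d\<close>] shift ..
      qed
      ultimately show ?thesis
        using True by simp
    next
      case False
      then have nd: "n \<in> V_ix d"
        using n by (auto simp: V_ix_def)
      have "coord (R z Y) (2, Suc d) = 0"
      proof (cases "n - 1 \<in> V_ix d")
        case True
        moreover have "Suc d \<noteq> n - 1"
          using nd unfolding V_ix_def atLeastAtMost_iff by linarith
        ultimately show ?thesis
          using entries(4)[OF z True top] by (simp add: X_Y_def)
      next
        case False
        then show ?thesis
          by (simp add: X_Y_def vvec_out tens_simps R_zero)
      qed
      then show ?thesis
        using entries(3)[OF z nd top] False by (simp add: W_def lookup_add X_Y_def)
    qed
    have "coord (K' x (vvec (Suc d) n)) m = (if m = n then c' else 0)" for m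
    proof -
      have "m \<notin> V_ix (Suc d) \<or> m \<in> V_ix d \<or> m = Suc (Suc d)"
        unfolding V_ix_def atLeastAtMost_iff by linarith
      then consider "m \<notin> V_ix (Suc d)" | "m \<in> V_ix d" | "m = Suc (Suc d)"
        by blast
      then show ?thesis
      proof cases
        case 1
        have "K' x (vvec (Suc d) n) \<in> span_of (V_ix (Suc d))"
          using lin(2) vvec_in_span_of by (auto simp: linear_op_def)
        then show ?thesis
          using 1 n coord_outside_span by fastforce
      next
        case 2
        then show ?thesis
          using main[of 1 m] coord_iota(1)[OF 2] W1[OF 2] K1W(1) nz[of m] by (simp split: if_splits)
      next
        case 3
        have "iota_coeff2 \<eta> d m \<noteq> 0"
          using sinh_multiple_nonzero[OF generic, of "Suc d"] \<eta> 3 by (simp add: iota_coeff2_def)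
        then show ?thesis
          using main[of 2 "Suc d"] coord_iota(2)[OF top] W2 K1W(2) 3 by (simp split: if_splits)
      qed
    qed
    then show ?thesis
      by (intro poly_mapping_eqI) (simp only: coord_smul vvec_in[OF n] coord_bvec c'_def l', simp)
  qed
  ultimately show ?thesis
    by (auto elim!: countable_subset[rotated])
qed

section \<open>From generic to all spectral parameters\<close>

lemma islimpt_co_countable:
  fixes x :: complex
  assumes "countable S"
  shows "x islimpt - S"
proof (rule islimptI)
  fix T :: "complex set"
  assume "x \<in> T" "open T"
  then obtain e where e: "e > 0" "ball x e \<subseteq> T"
    using openE by blast
  have "uncountable (ball x e - insert x S)"
    using e(1) assms by (intro uncountable_minus_countable uncountable_ball) simp_all
  then obtain y where "y \<in> ball x e - insert x S"
    by (metis countable_empty ex_in_conv)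
  then show "\<exists>y\<in>- S. y \<in> T \<and> y \<noteq> x"
    using e(2) by auto
qed

text \<open>
  The point \<open>x\<close> is a limit of points where \<open>f\<close> agrees with \<open>g\<close>. Along these \<open>f\<close> tends to \<open>g x\<close>, so
  \<open>x\<close> is not a pole, and at any other point a normalised meromorphic function equals its limit.
\<close>

lemma nicely_meromorphic_eq_continuous:
  assumes f: "f nicely_meromorphic_on UNIV" and g: "isCont g x"
    and eq: "countable {x. f x \<noteq> g x}"
  shows "f x = g x"
proof -
  let ?F = "at x within - {x. f x \<noteq> g x}"
  have nontriv: "?F \<noteq> bot"
    using islimpt_co_countable[OF eq] by (simp add: trivial_limit_within)
  have le: "?F \<le> at x"
    by (rule at_le) simp
  have "(g \<longlongrightarrow> g x) ?F"
    using g le unfolding isCont_def by (rule tendsto_mono[rotated])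
  then have fg: "(f \<longlongrightarrow> g x) ?F"
    by (rule Lim_transform_eventually) (auto simp: eventually_at_filter)
  consider "is_pole f x" | "f \<midarrow>x\<rightarrow> f x"
    using f by (auto simp: nicely_meromorphic_on_def)
  then show ?thesis
  proof cases
    case 1
    then have "filterlim f at_infinity ?F"
      unfolding is_pole_def by (rule filterlim_mono[OF _ order_refl le])
    then show ?thesis
      using not_tendsto_and_filterlim_at_infinity[OF nontriv fg] by blast
  next
    case 2
    then have "(f \<longlongrightarrow> f x) ?F"
      by (rule tendsto_mono[OF le])
    then show ?thesis
      using tendsto_unique[OF nontriv fg] by simp
  qed
qed

lemma isCont_C_coeff:
  assumes "\<And>j. j \<in> {1..n - 1} \<Longrightarrow> sinh (\<xi> + x + (l + 1 / 2 - of_nat j) * \<eta>) \<noteq> 0"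
  shows "isCont (\<lambda>x. C_coeff \<eta> l n x \<xi>) x"
  unfolding C_coeff_def using assms by (auto intro!: continuous_intros)

text \<open>
  Induction on the spin. The exceptional set of each step contains affine preimages of the previous
  one and of the exceptional set of \<open>R\<close>. Countability is a notion of smallness that survives this.
\<close>

lemma fused_K_generic:
  assumes generic: "\<And>m::nat. m > 0 \<Longrightarrow> exp \<eta> ^ m \<noteq> 1"
    and R: "\<And>d. d \<ge> 1 \<Longrightarrow> R_operator \<eta> 1 d (R d)"
    and K: "fused_K_operators \<eta> \<xi> R K"
  shows "countable {x. \<not> (\<forall>n\<in>V_ix d. K d x (vvec d n) = C_coeff \<eta> (of_nat d / 2) n x \<xi> \<cdot> vvec d n)}"
proof (induction d)
  case 0
  have "K 0 x (vvec 0 n) = C_coeff \<eta> (of_nat 0 / 2) n x \<xi> \<cdot> vvec 0 n" if "n \<in> V_ix 0" for x n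
    using K that vvec_in_span_of[of 0 n] by (auto simp: fused_K_operators_def V_ix_def)
  then show ?case
    by simp
next
  case (Suc d)
  have K1: "K 1 x (vvec 1 1) = vvec 1 1"
    "sinh (\<xi> + x) \<noteq> 0 \<Longrightarrow> K 1 x (vvec 1 2) = (sinh (\<xi> - x) / sinh (\<xi> + x)) \<cdot> vvec 1 2" for x
    using K unfolding fused_K_operators_def by blast+
  show ?case
  proof (cases "d = 0")
    case True
    have C: "C_coeff \<eta> (1 / 2) 2 x \<xi> = sinh (\<xi> - x) / sinh (\<xi> + x)" for x
      by (simp add: C_coeff_def)
    have V1: "n = 1 \<or> n = 2" if "n \<in> V_ix 1" for n
      using that by (auto simp: V_ix_def)
    have "K 1 x (vvec 1 n) = C_coeff \<eta> (1 / 2) n x \<xi> \<cdot> vvec 1 n"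
      if "sinh (1 * x + \<xi>) \<noteq> 0" "n \<in> V_ix 1" for x n
      using K1(1)[of x] K1(2)[of x] V1[OF that(2)] that(1) C[of x] by (auto simp: add.commute)
    then have "{x. \<not> (\<forall>n\<in>V_ix 1. K 1 x (vvec 1 n) = C_coeff \<eta> (1 / 2) n x \<xi> \<cdot> vvec 1 n)}
        \<subseteq> {x. sinh (1 * x + \<xi>) = 0}"
      by blast
    then show ?thesis
      using True countable_affine_sinh_zeros[of 1 \<xi>] countable_subset by simp
  next
    case False
    then have d: "d \<ge> 1"
      by simp
    have "\<forall>\<^sub>\<approx>x. \<forall>u \<in> span_of (V_ix (Suc d)).
        jmap \<eta> d (K (Suc d) x u) =
        perm_op ((K 1 (x - of_nat d / 2 * \<eta>) \<otimes>\<^sub>o id)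
          (R d (2 * x - (of_nat d / 2 - 1 / 2) * \<eta>)
            ((id \<otimes>\<^sub>o K d (x + \<eta> / 2)) (iota \<eta> d u))))"
      using K d unfolding fused_K_operators_def Suc_eq_plus1 by blast
    then have fusion: "countable {x. \<not> (\<forall>u \<in> span_of (V_ix (Suc d)).
        jmap \<eta> d (K (Suc d) x u) =
        perm_op ((K 1 (x - of_nat d / 2 * \<eta>) \<otimes>\<^sub>o id)
          (R d (2 * x - (of_nat d / 2 - 1 / 2) * \<eta>)
            ((id \<otimes>\<^sub>o K d (x + \<eta> / 2)) (iota \<eta> d u)))))}"
      unfolding eventually_cosparse using sparse_imp_countable[OF open_UNIV] by fastforce
    have lin: "linear_op (V_ix c) (V_ix c) (K c x)" for c x
      using K unfolding fused_K_operators_def by blast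
    show ?thesis
      by (rule fusion_step[OF generic d R[OF d] lin lin K1 fusion Suc.IH])
  qed
qed

theorem proposition4p6:
  fixes \<eta> \<xi> :: complex
    and R :: "nat \<Rightarrow> complex \<Rightarrow> (nat \<times> nat) opr"
    and K :: "nat \<Rightarrow> complex \<Rightarrow> nat opr"
  assumes generic: "\<And>m::nat. m > 0 \<Longrightarrow> exp \<eta> ^ m \<noteq> 1"
    and R: "\<And>d. d \<ge> 1 \<Longrightarrow> R_operator \<eta> 1 d (R d)"
    and K: "fused_K_operators \<eta> \<xi> R K"
  shows "\<forall>d n x. 1 \<le> n \<longrightarrow> n \<le> d + 1 \<longrightarrow>
    (\<forall>j \<in> {1..n - 1}. sinh (\<xi> + x + (of_nat d / 2 + 1 / 2 - of_nat j) * \<eta>) \<noteq> 0) \<longrightarrow>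
    K d x (vvec d n) = C_coeff \<eta> (of_nat d / 2) n x \<xi> \<cdot> vvec d n"
proof (intro allI impI poly_mapping_eqI)
  fix d n x m
  assume "1 \<le> n" "n \<le> d + 1"
    and den: "\<forall>j \<in> {1..n - 1}. sinh (\<xi> + x + (of_nat d / 2 + 1 / 2 - of_nat j) * \<eta>) \<noteq> 0"
  then have n: "n \<in> V_ix d"
    by (simp add: V_ix_def)
  show "coord (K d x (vvec d n)) m = coord (C_coeff \<eta> (of_nat d / 2) n x \<xi> \<cdot> vvec d n) m"
  proof (cases "m \<in> V_ix d")
    case True
    have "(\<lambda>x. coord (K d x (vvec d n)) m) nicely_meromorphic_on UNIV"
      using K n True unfolding fused_K_operators_def by blast
    moreover have "isCont (\<lambda>x. coord (C_coeff \<eta> (of_nat d / 2) n x \<xi> \<cdot> vvec d n) m) x"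
      using den by (auto intro!: continuous_intros isCont_C_coeff)
    moreover have "countable {x. coord (K d x (vvec d n)) m \<noteq> coord (C_coeff \<eta> (of_nat d / 2) n x \<xi> \<cdot> vvec d n) m}"
      by (rule countable_subset[OF _ fused_K_generic[OF generic R K, of d]]) (auto simp del: coord_smul intro!: bexI[OF _ n])
    ultimately show ?thesis
      by (rule nicely_meromorphic_eq_continuous)
  next
    case False
    have "K d x (vvec d n) \<in> span_of (V_ix d)"
      using K vvec_in_span_of unfolding fused_K_operators_def linear_op_def by blast
    then show ?thesis
      using False n by (auto simp: coord_outside_span vvec_in coord_bvec)
  qed
qed

end
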